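(* Let $\mathbb X$ be a Banach space over $\mathbb K=\mathbb R$ or $\mathbb C$ and let $\{\mathbf e_n,\mathbf e_n^*\}_{n=1}^\infty$ be a semi-normalized biorthogonal system in $\mathbb X\times\mathbb X^*$ whose vectors $\mathbf e_n$ have dense span (as in the context). Then for all $N\ge1$ $$\mathbf L_N\le k^c_{2N}+\tilde g_N\,\tilde\mu_N\qquad\text{and}\qquad\widetilde{\mathbf L}_N\le g_N^c+\tilde g_N\,\tilde\mu_N .$$ Moreover, there exists such a pair $(\mathbb X,\mathscr B)$, $\mathscr B=\{\mathbf e_n\}$, for which both inequalities are equalities for all $N\ge 1$.
   Context: Setting: $\mathbb X$ is a Banach space over $\mathbb K=\mathbb R$ or $\mathbb C$; $\{\mathbf e_n,\mathbf e_n^*\}_{n=1}^\infty\subset\mathbb X\times\mathbb X^*$ satisfies $\mathbf e_m^*(\mathbf e_n)=\delta_{m,n}$; $\mathscr B=\{\mathbf e_n\}$ has dense linear span in $\mathbb X$; and $0<\kappa_1\le\|\mathbf e_n\|,\|\mathbf e_n^*\|\le\kappa_2<\infty$ for all $n$. (Then $\lim_n\mathbf e_n^*(x)=0$ for all $x\in\mathbb X$.) Projections: for finite $A\subset\mathbb N$, $P_Ax=\sum_{n\in A}\mathbf e_n^*(x)\mathbf e_n$ (so $P_\emptyset=0$). Greedy sets: a finite set $\Gamma\subset\mathbb N$ is a greedy set for $x$ if $\min_{n\in\Gamma}|\mathbf e_n^*(x)|\ge\max_{n\in\Gamma^c}|\mathbf e_n^*(x)|$ (the empty set is considered greedy); $\mathscr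 G(x,N)$ is the collection of greedy sets for $x$ of cardinality $N$. $\mathscr G_N$ is the set of all maps $G:\mathbb X\to\mathbb X$ with $Gx=P_{\Gamma_x}x$ for some choice $\Gamma_x\in\mathscr G(x,N)$, for each $x$. Approximation errors: $\Sigma_N=\{\sum_{n\in A}a_n\mathbf e_n: |A|\le N,\ a_n\in\mathbb K\}$, $\sigma_N(x)=\operatorname{dist}(x,\Sigma_N)$, $\widetilde\sigma_N(x)=\inf\{\|x-P_Ax\|: |A|\le N\}$. Lebesgue constants: $\mathbf L_N$ (resp. $\widetilde{\mathbf L}_N$) is the smallest number such that $\|x-Gx\|\le\mathbf L_N\sigma_N(x)$ (resp. $\|x-Gx\|\le\widetilde{\mathbf L}_N\widetilde\sigma_N(x)$) for all $x\in\mathbb X$ and all $G\in\mathscr G_N$. Other constants: $k_N^c=\sup_{|A|\le N}\|I-P_A\|$; $g_N^c=\sup\{\|x-P_\Gamma x\|/\|x\|: x\ne0,\ \Gamma\in\mathscr G(x,k),\ 1\le k\le N\}$; $\tilde g_N=\sup\{\|P_\Gamma x-P_{\Gamma'}x\|/\|x\|: x\ne0,\ \Gamma\in\mathscr G(x,k),\ \Gamma'\in\mathscr G(x,m),\ \Gamma'\subset\Gamma,\ 0\le m<k\le N\}$. $\Upsilon$ is the set of sequences $\boldsymbol\varepsilon=\{\varepsilon_n\}$ in $\mathbb K$ with $|\varepsilon_n|=1$ for all $n$; $\mathbf 1_{\boldsymbol\varepsilon A}=\sum_{n\in A}\varepsilon_n\mathbf e_n$; $\tilde\mu_N=\sup\{\|\mathbf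 1_{\boldsymbol\varepsilon A}\|/\|\mathbf 1_{\boldsymbol\eta B}\|: |A|=|B|\le N,\ \boldsymbol\varepsilon,\boldsymbol\eta\in\Upsilon\}$ (nonempty finite sets). *)

theory Defs
  imports "HOL-Analysis.Analysis" "HOL-Library.Function_Algebras"
begin

text \<open>
  A Banach space is a subspace \<open>X\<close> of a vector space over \<open>'k\<close>, with a complete norm \<open>nrm\<close> on \<open>X\<close>;
  values of \<open>nrm\<close> outside \<open>X\<close> are irrelevant.  An explicit carrier and an explicit
  scalar multiplication are used because the distribution has no type class of complex Banach
  spaces, and because the existence of a space can only be asserted over subsets of a type.
  The scalar field is meant to be instantiated with \<open>real\<close> and \<open>complex\<close>.  Every separable Banach
  space over \<open>'k\<close> has cardinality at most that of \<open>nat \<Rightarrow> 'k\<close> and, as a vector space, embeds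
  linearly in \<open>nat \<Rightarrow> 'k\<close>, so nothing is lost by looking for examples with carrier in that type.
\<close>

locale banach_space_on = vector_space scale
  for scale :: "'k::real_normed_field \<Rightarrow> 'x::ab_group_add \<Rightarrow> 'x" (infixr \<open>*s\<close> 75) +
  fixes X :: "'x set"
    and nrm :: "'x \<Rightarrow> real"
  assumes carrier_subspace: "module.subspace scale X"
    and nrm_nonneg: "x \<in> X \<Longrightarrow> 0 \<le> nrm x"
    and nrm_eq_zero: "x \<in> X \<Longrightarrow> nrm x = 0 \<longleftrightarrow> x = 0"
    and nrm_scale: "x \<in> X \<Longrightarrow> nrm (c *s x) = norm c * nrm x"
    and nrm_triangle: "x \<in> X \<Longrightarrow> y \<in> X \<Longrightarrow> nrm (x + y) \<le> nrm x + nrm y"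
    and nrm_complete:
      "(\<And>n::nat. s n \<in> X) \<Longrightarrow>
       (\<forall>\<epsilon>>0. \<exists>M. \<forall>m\<ge>M. \<forall>n\<ge>M. nrm (s m - s n) < \<epsilon>) \<Longrightarrow>
       \<exists>l\<in>X. (\<lambda>n. nrm (s n - l)) \<longlonglongrightarrow> 0"
begin

text \<open>
  All suprema and infima are taken in \<^typ>\<open>ennreal\<close>, so that no boundedness side condition is
  hidden in them: an unbounded functional has norm \<open>\<infinity>\<close>.
\<close>

definition dual_norm :: "('x \<Rightarrow> 'k) \<Rightarrow> ennreal" where
  "dual_norm \<phi> = (SUP x\<in>{x \<in> X. nrm x \<le> 1}. ennreal (norm (\<phi> x)))"

definition op_norm :: "('x \<Rightarrow> 'x) \<Rightarrow> ennreal" where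
  "op_norm T = (SUP x\<in>{x \<in> X. nrm x \<le> 1}. ennreal (nrm (T x)))"

end

text \<open>
  The basis is indexed by all natural numbers, starting at \<open>0\<close>.
  The two bounds on \<open>dual_norm\<close> make every \<open>e\<^sup>* n\<close> an element of the dual of \<open>X\<close>.
\<close>

locale seminormalized_system = banach_space_on scale X nrm
  for scale :: "'k::real_normed_field \<Rightarrow> 'x::ab_group_add \<Rightarrow> 'x" (infixr \<open>*s\<close> 75)
    and X :: "'x set"
    and nrm :: "'x \<Rightarrow> real" +
  fixes e :: "nat \<Rightarrow> 'x"
    and estar :: "nat \<Rightarrow> 'x \<Rightarrow> 'k" (\<open>e\<^sup>*\<close>)
  assumes basis_in: "e n \<in> X"
    and estar_add: "x \<in> X \<Longrightarrow> y \<in> X \<Longrightarrow> e\<^sup>* n (x + y) = e\<^sup>* n x + e\<^sup>* n y"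
    and estar_scale: "x \<in> X \<Longrightarrow> e\<^sup>* n (c *s x) = c * e\<^sup>* n x"
    and biorthogonal: "e\<^sup>* m (e n) = (if m = n then 1 else 0)"
    and dense_span: "x \<in> X \<Longrightarrow> 0 < \<epsilon> \<Longrightarrow> \<exists>y\<in>module.span scale (range e). nrm (x - y) < \<epsilon>"
    and seminormalized:
      "\<exists>\<kappa>\<^sub>1 \<kappa>\<^sub>2 :: real. 0 < \<kappa>\<^sub>1 \<and>
         (\<forall>n. \<kappa>\<^sub>1 \<le> nrm (e n) \<and> nrm (e n) \<le> \<kappa>\<^sub>2 \<and>
              ennreal \<kappa>\<^sub>1 \<le> dual_norm (e\<^sup>* n) \<and> dual_norm (e\<^sup>* n) \<le> ennreal \<kappa>\<^sub>2)"
begin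

definition P :: "nat set \<Rightarrow> 'x \<Rightarrow> 'x" where
  "P A x = (\<Sum>n\<in>A. e\<^sup>* n x *s e n)"

text \<open>
  The condition is \<open>min\<^bsub>n\<in>\<Gamma>\<^esub> |e\<^sup>* n x| \<ge> max\<^bsub>m\<notin>\<Gamma>\<^esub> |e\<^sup>* m x|\<close>, with no requirement when \<open>\<Gamma> = {}\<close>.
\<close>

definition greedy_sets :: "'x \<Rightarrow> nat \<Rightarrow> nat set set" where
  "greedy_sets x N =
     {\<Gamma>. finite \<Gamma> \<and> card \<Gamma> = N \<and> (\<forall>n\<in>\<Gamma>. \<forall>m\<in>-\<Gamma>. norm (e\<^sup>* m x) \<le> norm (e\<^sup>* n x))}"

definition greedy_operators :: "nat \<Rightarrow> ('x \<Rightarrow> 'x) set" where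
  "greedy_operators N = {G. \<forall>x\<in>X. \<exists>\<Gamma>\<in>greedy_sets x N. G x = P \<Gamma> x}"

definition Sigma_N :: "nat \<Rightarrow> 'x set" where
  "Sigma_N N = {\<Sum>n\<in>A. a n *s e n | A a. finite A \<and> card A \<le> N}"

definition sigma :: "nat \<Rightarrow> 'x \<Rightarrow> ennreal" where
  "sigma N x = (INF y\<in>Sigma_N N. ennreal (nrm (x - y)))"

definition sigma_tilde :: "nat \<Rightarrow> 'x \<Rightarrow> ennreal" where
  "sigma_tilde N x = (INF A\<in>{A. finite A \<and> card A \<le> N}. ennreal (nrm (x - P A x)))"

definition L :: "nat \<Rightarrow> ennreal" where
  "L N = Inf {C. \<forall>x\<in>X. \<forall>G\<in>greedy_operators N. ennreal (nrm (x - G x)) \<le> C * sigma N x}"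

definition L_tilde :: "nat \<Rightarrow> ennreal" where
  "L_tilde N = Inf {C. \<forall>x\<in>X. \<forall>G\<in>greedy_operators N. ennreal (nrm (x - G x)) \<le> C * sigma_tilde N x}"

definition kc :: "nat \<Rightarrow> ennreal" where
  "kc N = (SUP A\<in>{A. finite A \<and> card A \<le> N}. op_norm (\<lambda>x. x - P A x))"

definition gc :: "nat \<Rightarrow> ennreal" where
  "gc N = Sup {ennreal (nrm (x - P \<Gamma> x) / nrm x) | x \<Gamma> k.
     x \<in> X \<and> x \<noteq> 0 \<and> \<Gamma> \<in> greedy_sets x k \<and> 1 \<le> k \<and> k \<le> N}"

definition g_tilde :: "nat \<Rightarrow> ennreal" where
  "g_tilde N = Sup {ennreal (nrm (P \<Gamma> x - P \<Gamma>' x) / nrm x) | x \<Gamma> \<Gamma>' k m.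
     x \<in> X \<and> x \<noteq> 0 \<and> \<Gamma> \<in> greedy_sets x k \<and> \<Gamma>' \<in> greedy_sets x m \<and> \<Gamma>' \<subset> \<Gamma> \<and> m < k \<and> k \<le> N}"

text \<open>
  In \<open>mu_tilde\<close> no denominator vanishes: biorthogonality makes \<open>one_vec \<eta> B\<close> nonzero for \<open>B \<noteq> {}\<close>.
\<close>

definition Upsilon :: "(nat \<Rightarrow> 'k) set" where
  "Upsilon = {\<epsilon>. \<forall>n. norm (\<epsilon> n) = 1}"

definition one_vec :: "(nat \<Rightarrow> 'k) \<Rightarrow> nat set \<Rightarrow> 'x" where
  "one_vec \<epsilon> A = (\<Sum>n\<in>A. \<epsilon> n *s e n)"

definition mu_tilde :: "nat \<Rightarrow> ennreal" where
  "mu_tilde N = Sup {ennreal (nrm (one_vec \<epsilon> A) / nrm (one_vec \<eta> B)) | A B \<epsilon> \<eta>.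
     finite A \<and> finite B \<and> A \<noteq> {} \<and> B \<noteq> {} \<and> card A = card B \<and> card B \<le> N \<and>
     \<epsilon> \<in> Upsilon \<and> \<eta> \<in> Upsilon}"

end

end

theory Submission
  imports Defs
begin

text \<open>
  Let \<open>\<Gamma>\<close> be a greedy set for \<open>x\<close>, let \<open>z\<close> be supported on \<open>A\<close> with \<open>|A| \<le> N\<close>, and put \<open>y = x - z\<close>.
  Then \<open>x - P \<Gamma> x = (I - P (A \<union> \<Gamma>)) y + P (A - \<Gamma>) x\<close>.  By convexity the second term is at most
  \<open>t\<close> times the norm of a sum of unimodular multiples of the \<open>e n\<close>, \<open>n \<in> A - \<Gamma>\<close>, for any \<open>t\<close> bounding
  the coefficients of \<open>x\<close> there.  Now \<open>mu_tilde\<close> allows \<open>A - \<Gamma>\<close> to be exchanged for a greedy set \<open>B\<close> of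
  \<open>y\<close> of the same size, and \<open>t\<close> times the sum of the \<open>sgn (e\<^sup>* n y) e n\<close>, \<open>n \<in> B\<close>, is a convex combination of
  differences of greedy projections of \<open>y\<close>, which are controlled by \<open>g_tilde\<close>.

  Equality holds in \<open>\<ell>\<^sub>1 \<oplus>\<^sub>\<infinity> c\<^sub>0\<close>, with the basis of \<open>\<ell>\<^sub>1\<close> on the even and that of \<open>c\<^sub>0\<close> on the odd indices:
  all projections are contractive and \<open>mu_tilde N \<le> N\<close>, while for \<open>x = \<Sum>\<^sub>n\<^sub>\<le>\<^sub>2\<^sub>N e n\<close> removing the \<open>N\<close> odd
  terms, a greedy choice, leaves an error of norm \<open>N + 1\<close>, and removing \<open>N\<close> of the even ones an error
  of norm \<open>1\<close>.
\<close>

no_notation vector_scalar_mult (infixl "*s" 70)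

section \<open>Extended nonnegative reals and unimodular signs\<close>

text \<open>The constants are extended nonnegative suprema of quotients. Once such a supremum is
  known to be finite, this recovers the real inequality that each quotient encodes.\<close>

lemma ennreal_Sup_ratio:
  assumes "ennreal (a / b) \<in> S" "Sup S = ennreal c" "0 \<le> c" "0 < b"
  shows "a \<le> c * b"
proof -
  have "ennreal (a / b) \<le> ennreal c"
    using Sup_upper[OF assms(1)] assms(2) by simp
  then show ?thesis
    using assms(3,4) by (simp add: ennreal_le_iff field_simps)
qed

lemma ennreal_real_obtain:
  assumes "(c::ennreal) < top"
  obtains r where "c = ennreal r" "0 \<le> r"
  using assms by (cases c) auto

lemma ennreal_le_mult:
  assumes "a \<le> c * b" "0 \<le> c" "0 \<le> b"
  shows "ennreal a \<le> ennreal c * ennreal b"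
  using assms by (metis ennreal_leI ennreal_mult)

text \<open>\<open>sigma\<close> and \<open>sigma_tilde\<close> are infima, so a bound proved for
  each approximant passes to them on dividing by C. Finiteness of C matters: with C infinite and an
  infimum 0 that is not attained, the product would be 0. For C = 0 a single index already forces a
  = 0, hence the nonempty index set.\<close>

lemma ennreal_le_mult_INF:
  fixes C :: ennreal
  assumes "C < top" "I \<noteq> {}" and le: "\<And>i. i \<in> I \<Longrightarrow> a \<le> C * f i"
  shows "a \<le> C * (INF i\<in>I. f i)"
proof (cases "C = 0")
  case True
  with assms show ?thesis by fastforce
next
  case False
  have "a / C \<le> f i" if "i \<in> I" for i
    using le[OF that] False \<open>C < top\<close>
    by (metis divide_right_mono_ennreal ennreal_mult_divide_eq mult.commute top.not_eq_extremum)
  then have "a / C \<le> (INF i\<in>I. f i)"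
    by (rule INF_greatest)
  then have "C * (a / C) \<le> C * (INF i\<in>I. f i)"
    by (rule mult_left_mono) simp
  moreover have "C * (a / C) = a"
    using False \<open>C < top\<close> ennreal_mult_divide_eq[of C a]
    by (simp add: ennreal_times_divide mult.commute)
  ultimately show ?thesis by simp
qed

text \<open>The value 1 at 0 keeps every sign unimodular, so a sequence of signs always lies in
  \<open>Upsilon\<close>, while a is still its modulus times its sign.\<close>

definition unit_sign :: "'k::real_normed_field \<Rightarrow> 'k" where
  "unit_sign a = (if a = 0 then 1 else a / of_real (norm a))"

lemma norm_unit_sign: "norm (unit_sign a) = 1"
  by (simp add: unit_sign_def norm_divide)

lemma norm_mult_unit_sign: "of_real (norm a) * unit_sign a = a"
  by (simp add: unit_sign_def)

section \<open>The carrier and its norm\<close>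

context banach_space_on
begin

lemma carrier_zero: "0 \<in> X"
  using carrier_subspace by (rule subspace_0)

lemma carrier_add: "x \<in> X \<Longrightarrow> y \<in> X \<Longrightarrow> x + y \<in> X"
  using carrier_subspace by (rule subspace_add)

lemma carrier_diff: "x \<in> X \<Longrightarrow> y \<in> X \<Longrightarrow> x - y \<in> X"
  using carrier_subspace by (rule subspace_diff)

lemma carrier_scale: "x \<in> X \<Longrightarrow> c *s x \<in> X"
  using carrier_subspace by (rule subspace_scale)

lemma carrier_sum: "(\<And>i. i \<in> I \<Longrightarrow> f i \<in> X) \<Longrightarrow> sum f I \<in> X"
  using carrier_subspace by (rule subspace_sum)

lemmas carrier_intros = carrier_zero carrier_add carrier_diff carrier_scale carrier_sum

lemma nrm_zero: "nrm 0 = 0"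
  using nrm_eq_zero[OF carrier_zero] by simp

lemma nrm_diff_le: "x \<in> X \<Longrightarrow> y \<in> X \<Longrightarrow> nrm (x - y) \<le> nrm x + nrm y"
  using nrm_triangle[of x "(-1) *s y"] nrm_scale[of y "-1"] carrier_scale[of y "-1"] by simp

lemma nrm_sum_le:
  assumes "\<And>i. i \<in> I \<Longrightarrow> f i \<in> X"
  shows "nrm (sum f I) \<le> (\<Sum>i\<in>I. nrm (f i))"
  using assms
proof (induction I rule: infinite_finite_induct)
  case (insert i I)
  have "nrm (f i + sum f I) \<le> nrm (f i) + nrm (sum f I)"
    using insert.prems by (intro nrm_triangle carrier_sum) auto
  with insert show ?case by auto
qed (auto simp: nrm_zero)

text \<open>
  The sum is an integral over \<open>s\<close> of the sums over the superlevel sets \<open>{s \<le> w}\<close>.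
  The induction peels off the smallest positive value of \<open>w\<close>.
\<close>

lemma nrm_weighted_sum_le:
  fixes w :: "'i \<Rightarrow> real"
  assumes "finite S" and v: "\<And>n. n \<in> S \<Longrightarrow> v n \<in> X"
    and "\<And>n. n \<in> S \<Longrightarrow> 0 \<le> w n" "\<And>n. n \<in> S \<Longrightarrow> w n \<le> m" "0 \<le> m"
    and "\<And>s. 0 < s \<Longrightarrow> nrm (\<Sum>n\<in>{n \<in> S. s \<le> w n}. v n) \<le> M"
  shows "nrm (\<Sum>n\<in>S. of_real (w n) *s v n) \<le> m * M"
  using assms(3-)
proof (induction "card {n \<in> S. 0 < w n}" arbitrary: w m rule: less_induct)
  case less
  define S' where "S' = {n \<in> S. 0 < w n}"
  \<comment> \<open>Level 1 is an arbitrary choice: the hypothesis at any positive level yields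
    \<open>0 \<le> M\<close>.\<close>
  have "0 \<le> nrm (\<Sum>n\<in>{n \<in> S. 1 \<le> w n}. v n)"
    by (intro nrm_nonneg carrier_sum) (use v in auto)
  also have "\<dots> \<le> M"
    by (rule less.prems(4)) simp
  finally have "0 \<le> M" .
  show ?case
  proof (cases "S' = {}")
    case True
    then have "w n = 0" if "n \<in> S" for n
      using less.prems(1)[OF that] that unfolding S'_def by force
    then show ?thesis
      using \<open>0 \<le> M\<close> \<open>0 \<le> m\<close> by (simp add: nrm_zero)
  next
    case False
    have [simp]: "finite S'"
      using \<open>finite S\<close> unfolding S'_def by simp
    define d where "d = Min (w ` S')"
    have "d \<in> w ` S'"
      using False unfolding d_def by (intro Min_in) auto
    then obtain i where i: "i \<in> S'" "w i = d" by auto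
    have dle: "d \<le> w n" if "n \<in> S'" for n
      using that unfolding d_def by simp
    have "0 < d" using i unfolding S'_def by auto
    have "d \<le> m" using i less.prems(2) unfolding S'_def by auto
    \<comment> \<open>Lowering the weights by d, truncated at 0, keeps the hypothesis on superlevel
      sets, since \<open>{s \<le> w'}\<close> is \<open>{s + d \<le> w}\<close>; it lowers the upper
      bound to m - d and makes the weight at i vanish, so the induction applies. What is taken away
      is d times the sum over \<open>S'\<close>, itself the superlevel set at d.\<close>
    define w' where "w' = (\<lambda>n. max 0 (w n - d))"
    have S'_eq: "S' = {n \<in> S. d \<le> w n}"
      using dle \<open>0 < d\<close> unfolding S'_def by fastforce
    have split: "of_real (w n) *s v n =
        of_real (w' n) *s v n + (if n \<in> S' then of_real d *s v n else 0)" if "n \<in> S" for n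
    proof (cases "n \<in> S'")
      case True
      then have "w n = w' n + d" using dle unfolding w'_def by fastforce
      then show ?thesis using True by (simp add: scale_left_distrib)
    next
      case False
      then have "w n = 0" "w' n = 0"
        using less.prems(1)[OF that] that \<open>0 < d\<close> unfolding S'_def w'_def by force+
      then show ?thesis using False by simp
    qed
    have IH: "nrm (\<Sum>n\<in>S. of_real (w' n) *s v n) \<le> (m - d) * M"
    proof (rule less.hyps)
      have "{n \<in> S. 0 < w' n} \<subseteq> S' - {i}"
        using i \<open>0 < d\<close> unfolding w'_def S'_def by auto
      then have "card {n \<in> S. 0 < w' n} \<le> card (S' - {i})"
        by (intro card_mono) auto
      also have "\<dots> < card S'"
        using i by (intro psubset_card_mono) auto
      finally show "card {n \<in> S. 0 < w' n} < card {n \<in> S. 0 < w n}"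
        unfolding S'_def .
    next
      fix s :: real assume "0 < s"
      then have "{n \<in> S. s \<le> w' n} = {n \<in> S. s + d \<le> w n}"
        unfolding w'_def by auto
      then show "nrm (\<Sum>n\<in>{n \<in> S. s \<le> w' n}. v n) \<le> M"
        using less.prems(4)[of "s + d"] \<open>0 < s\<close> \<open>0 < d\<close> by simp
    next
      fix n assume "n \<in> S"
      then show "w' n \<le> m - d"
        using less.prems(2)[of n] \<open>d \<le> m\<close> unfolding w'_def by auto
    qed (use \<open>d \<le> m\<close> in \<open>auto simp: w'_def\<close>)
    have "nrm (of_real d *s (\<Sum>n\<in>S'. v n)) = d * nrm (\<Sum>n\<in>S'. v n)"
      using \<open>0 < d\<close> v by (subst nrm_scale) (auto intro!: carrier_sum simp: S'_def)
    also have "\<dots> \<le> d * M"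
      using less.prems(4)[of d] \<open>0 < d\<close> unfolding S'_eq by simp
    finally have d_part: "nrm (of_real d *s (\<Sum>n\<in>S'. v n)) \<le> d * M" .
    have "(\<Sum>n\<in>S. of_real (w n) *s v n) =
        (\<Sum>n\<in>S. of_real (w' n) *s v n) + (\<Sum>n\<in>S. if n \<in> S' then of_real d *s v n else 0)"
      by (simp add: split sum.distrib)
    also have "(\<Sum>n\<in>S. if n \<in> S' then of_real d *s v n else 0) = of_real d *s (\<Sum>n\<in>S'. v n)"
      using \<open>finite S\<close> by (simp add: scale_sum_right sum.If_cases S'_def Int_def conj_commute)
    finally have "nrm (\<Sum>n\<in>S. of_real (w n) *s v n)
        \<le> nrm (\<Sum>n\<in>S. of_real (w' n) *s v n) + nrm (of_real d *s (\<Sum>n\<in>S'. v n))"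
      using v by (auto intro!: nrm_triangle carrier_intros simp: S'_def)
    with IH d_part show ?thesis
      by (simp add: algebra_simps)
  qed
qed

end

section \<open>Coefficient functionals and coordinate projections\<close>

context seminormalized_system
begin

lemma estar_zero: "e\<^sup>* n 0 = 0"
  using estar_scale[OF carrier_zero, of n 0] by simp

lemma estar_diff: "x \<in> X \<Longrightarrow> y \<in> X \<Longrightarrow> e\<^sup>* n (x - y) = e\<^sup>* n x - e\<^sup>* n y"
  using estar_add[of x "(-1) *s y" n] estar_scale[of y n "-1"] carrier_scale[of y "-1"] by simp

lemma estar_sum:
  assumes "\<And>i. i \<in> I \<Longrightarrow> f i \<in> X"
  shows "e\<^sup>* n (sum f I) = (\<Sum>i\<in>I. e\<^sup>* n (f i))"
  using assms
  by (induction I rule: infinite_finite_induct) (auto simp: estar_zero estar_add carrier_sum)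

lemma estar_comb:
  assumes "finite A"
  shows "e\<^sup>* m (\<Sum>n\<in>A. a n *s e n) = (if m \<in> A then a m else 0)"
proof -
  have "e\<^sup>* m (\<Sum>n\<in>A. a n *s e n) = (\<Sum>n\<in>A. if m = n then a n else 0)"
    by (subst estar_sum) (auto simp: carrier_scale basis_in estar_scale biorthogonal intro!: sum.cong)
  also have "\<dots> = (if m \<in> A then a m else 0)"
    using assms by simp
  finally show ?thesis .
qed

lemma comb_in: "(\<Sum>n\<in>A. a n *s e n) \<in> X"
  by (intro carrier_intros basis_in)

lemma P_in: "P A x \<in> X"
  unfolding P_def by (rule comb_in)

lemma one_vec_in: "one_vec \<epsilon> A \<in> X"
  unfolding one_vec_def by (rule comb_in)

lemma estar_P: "finite A \<Longrightarrow> e\<^sup>* m (P A x) = (if m \<in> A then e\<^sup>* m x else 0)"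
  unfolding P_def by (rule estar_comb)

lemma estar_one_vec: "finite A \<Longrightarrow> e\<^sup>* m (one_vec \<epsilon> A) = (if m \<in> A then \<epsilon> m else 0)"
  unfolding one_vec_def by (rule estar_comb)

lemma P_empty: "P {} x = 0"
  by (simp add: P_def)

lemma P_disjoint_union:
  "finite A \<Longrightarrow> finite B \<Longrightarrow> A \<inter> B = {} \<Longrightarrow> P (A \<union> B) x = P A x + P B x"
  unfolding P_def by (rule sum.union_disjoint)

lemma P_cong: "(\<And>n. n \<in> A \<Longrightarrow> e\<^sup>* n x = e\<^sup>* n y) \<Longrightarrow> P A x = P A y"
  unfolding P_def by (auto intro: sum.cong)

lemma basis_nonzero: "e n \<noteq> 0"
  using biorthogonal[of n n] estar_zero[of n] by auto

text \<open>\<open>dual_norm\<close> tests only the unit ball. Applying its bound to x divided by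
  \<open>nrm x\<close> gives a real inequality for every x in the carrier; the upper constant of
  \<open>seminormalized\<close> serves vectors and functionals alike.\<close>

lemma system_bound:
  obtains \<kappa> where "0 < \<kappa>" "\<And>n. nrm (e n) \<le> \<kappa>"
    "\<And>n x. x \<in> X \<Longrightarrow> norm (e\<^sup>* n x) \<le> \<kappa> * nrm x"
proof -
  obtain \<kappa>\<^sub>1 \<kappa> :: real where \<kappa>: "0 < \<kappa>\<^sub>1" "\<And>n. \<kappa>\<^sub>1 \<le> nrm (e n)" "\<And>n. nrm (e n) \<le> \<kappa>"
    "\<And>n. dual_norm (e\<^sup>* n) \<le> ennreal \<kappa>"
    using seminormalized by blast
  have pos: "0 < \<kappa>"
    using \<kappa>(1) \<kappa>(2)[of 0] \<kappa>(3)[of 0] by linarith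
  have "norm (e\<^sup>* n x) \<le> \<kappa> * nrm x" if x: "x \<in> X" for n x
  proof (cases "x = 0")
    case True
    then show ?thesis by (simp add: estar_zero nrm_zero)
  next
    case False
    then have nx: "0 < nrm x"
      using nrm_nonneg[OF x] nrm_eq_zero[OF x] by fastforce
    define u where "u = of_real (inverse (nrm x)) *s x"
    have u: "u \<in> X" "nrm u \<le> 1"
      using nx x unfolding u_def by (auto simp: carrier_scale nrm_scale norm_inverse)
    then have "ennreal (norm (e\<^sup>* n u)) \<le> dual_norm (e\<^sup>* n)"
      unfolding dual_norm_def by (intro SUP_upper) auto
    then have "ennreal (norm (e\<^sup>* n u)) \<le> ennreal \<kappa>"
      using \<kappa>(4) order_trans by blast
    then have "norm (e\<^sup>* n u) \<le> \<kappa>"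
      using pos by (simp add: ennreal_le_iff)
    then show ?thesis
      using nx x unfolding u_def by (simp add: estar_scale norm_divide divide_simps mult.commute)
  qed
  then show thesis
    using pos \<kappa>(3) that by blast
qed

lemma finite_support_span:
  assumes "y \<in> span (range e)"
  shows "finite {n. e\<^sup>* n y \<noteq> 0}"
proof -
  have "y \<in> X \<and> finite {n. e\<^sup>* n y \<noteq> 0}"
    using assms
  proof (induction rule: span_induct_alt)
    case base
    then show ?case by (simp add: carrier_zero estar_zero)
  next
    case (step c x y)
    then obtain k where k: "x = e k" by auto
    have "{n. e\<^sup>* n (c *s x + y) \<noteq> 0} \<subseteq> insert k {n. e\<^sup>* n y \<noteq> 0}"
      using step k
      by (auto simp: estar_add estar_scale carrier_scale basis_in biorthogonal split: if_splits)
    then show ?case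
      using step k by (auto intro: finite_subset intro!: carrier_intros basis_in)
  qed
  then show ?thesis by simp
qed

lemma span_subset_carrier: "span (range e) \<subseteq> X"
  using carrier_subspace basis_in by (intro span_minimal) auto

text \<open>In other words, the coefficients of x tend to 0. A vector y of the span close enough to
  x has coefficients within \<delta> of those of x, uniformly in n, so a coefficient of modulus at
  least \<delta> can occur only on the finite support of y.\<close>

lemma finite_large_coefficients:
  assumes x: "x \<in> X" and "0 < \<delta>"
  shows "finite {n. \<delta> \<le> norm (e\<^sup>* n x)}"
proof -
  obtain \<kappa> where \<kappa>: "0 < \<kappa>" "\<And>n x. x \<in> X \<Longrightarrow> norm (e\<^sup>* n x) \<le> \<kappa> * nrm x"
    using system_bound by metis
  obtain y where y: "y \<in> span (range e)" "nrm (x - y) < \<delta> / \<kappa>"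
    using dense_span[OF x, of "\<delta> / \<kappa>"] \<kappa>(1) \<open>0 < \<delta>\<close> by auto
  have yX: "y \<in> X" using y span_subset_carrier by auto
  have "norm (e\<^sup>* n x - e\<^sup>* n y) < \<delta>" for n
  proof -
    have "norm (e\<^sup>* n x - e\<^sup>* n y) \<le> \<kappa> * nrm (x - y)"
      using \<kappa>(2)[OF carrier_diff[OF x yX]] by (simp add: estar_diff x yX)
    also have "\<dots> < \<delta>"
      using y(2) \<kappa>(1) by (simp add: field_simps)
    finally show ?thesis .
  qed
  then have "{n. \<delta> \<le> norm (e\<^sup>* n x)} \<subseteq> {n. e\<^sup>* n y \<noteq> 0}"
    by (auto simp: not_le) (metis diff_zero leD)
  then show ?thesis
    using finite_support_span[OF y(1)] finite_subset by blast
qed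

section \<open>Existence of greedy sets\<close>

lemma greedy_setsD:
  assumes "\<Gamma> \<in> greedy_sets x N"
  shows "finite \<Gamma>" "card \<Gamma> = N"
    "\<And>n m. n \<in> \<Gamma> \<Longrightarrow> m \<notin> \<Gamma> \<Longrightarrow> norm (e\<^sup>* m x) \<le> norm (e\<^sup>* n x)"
  using assms unfolding greedy_sets_def by auto

text \<open>An index with the largest coefficient outside \<Gamma> can always be added. If some
  outside coefficient is nonzero, only finitely many are at least as large by
  \<open>finite_large_coefficients\<close>, so a maximum is attained; if all vanish, any index
  outside \<Gamma> will do.\<close>

lemma greedy_sets_nonempty:
  assumes x: "x \<in> X"
  shows "\<exists>\<Gamma>. \<Gamma> \<in> greedy_sets x N"
proof (induction N)
  case 0
  have "{} \<in> greedy_sets x 0" by (simp add: greedy_sets_def)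
  then show ?case ..
next
  case (Suc N)
  then obtain \<Gamma> where "\<Gamma> \<in> greedy_sets x N" ..
  note \<Gamma> = greedy_setsD[OF this]
  have "\<exists>k. k \<notin> \<Gamma> \<and> (\<forall>m. m \<notin> \<Gamma> \<longrightarrow> norm (e\<^sup>* m x) \<le> norm (e\<^sup>* k x))"
  proof (cases "\<exists>j. j \<notin> \<Gamma> \<and> e\<^sup>* j x \<noteq> 0")
    case False
    obtain k where "k \<notin> \<Gamma>"
      using ex_new_if_finite[OF infinite_UNIV_nat \<Gamma>(1)] ..
    moreover have "\<forall>m. m \<notin> \<Gamma> \<longrightarrow> e\<^sup>* m x = 0"
      using False by blast
    ultimately have "k \<notin> \<Gamma> \<and> (\<forall>m. m \<notin> \<Gamma> \<longrightarrow> norm (e\<^sup>* m x) \<le> norm (e\<^sup>* k x))"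
      by simp
    then show ?thesis ..
  next
    case True
    then obtain j where j: "j \<notin> \<Gamma>" "e\<^sup>* j x \<noteq> 0" by auto
    define S where "S = {n. norm (e\<^sup>* j x) \<le> norm (e\<^sup>* n x)} - \<Gamma>"
    have "finite S" "S \<noteq> {}"
      using finite_large_coefficients[OF x, of "norm (e\<^sup>* j x)"] j unfolding S_def by auto
    then have fin: "finite ((\<lambda>n. norm (e\<^sup>* n x)) ` S)" "(\<lambda>n. norm (e\<^sup>* n x)) ` S \<noteq> {}"
      by simp_all
    obtain k where "k \<in> S" and k: "norm (e\<^sup>* k x) = Max ((\<lambda>n. norm (e\<^sup>* n x)) ` S)"
      using Max_in[OF fin] by (elim imageE) simp
    have "norm (e\<^sup>* m x) \<le> norm (e\<^sup>* k x)" if "m \<notin> \<Gamma>" for m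
    proof (cases "m \<in> S")
      case True
      then show ?thesis unfolding k using fin(1) by simp
    next
      case False
      with that \<open>k \<in> S\<close> show ?thesis unfolding S_def by simp
    qed
    with \<open>k \<in> S\<close> have "k \<notin> \<Gamma> \<and> (\<forall>m. m \<notin> \<Gamma> \<longrightarrow> norm (e\<^sup>* m x) \<le> norm (e\<^sup>* k x))"
      unfolding S_def by simp
    then show ?thesis ..
  qed
  then obtain k where k: "k \<notin> \<Gamma>" "\<And>m. m \<notin> \<Gamma> \<Longrightarrow> norm (e\<^sup>* m x) \<le> norm (e\<^sup>* k x)"
    by blast
  have "norm (e\<^sup>* m x) \<le> norm (e\<^sup>* n x)" if "n \<in> insert k \<Gamma>" "m \<notin> insert k \<Gamma>" for n m
    using that k(2)[of m] \<Gamma>(3)[of n m] by (cases "n = k") simp_all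
  then have "insert k \<Gamma> \<in> greedy_sets x (Suc N)"
    using k(1) \<Gamma>(1,2) unfolding greedy_sets_def by simp
  then show ?case ..
qed

section \<open>Finiteness of the constants\<close>

text \<open>The triangle inequality over at most N terms, each of norm at most
  \<open>\<kappa>\<^sup>2 * nrm x\<close>. The bound is crude, but it makes \<open>kc\<close>,
  \<open>gc\<close> and \<open>g_tilde\<close> finite, so that the main estimates can be carried out
  with real numbers.\<close>

lemma nrm_P_le:
  obtains K where "0 \<le> K"
    "\<And>A x. finite A \<Longrightarrow> card A \<le> N \<Longrightarrow> x \<in> X \<Longrightarrow> nrm (P A x) \<le> K * nrm x"
proof -
  obtain \<kappa> where \<kappa>: "0 < \<kappa>" "\<And>n. nrm (e n) \<le> \<kappa>"
    "\<And>n x. x \<in> X \<Longrightarrow> norm (e\<^sup>* n x) \<le> \<kappa> * nrm x"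
    using system_bound by metis
  have "nrm (P A x) \<le> real N * \<kappa>\<^sup>2 * nrm x" if "finite A" "card A \<le> N" "x \<in> X" for A x
  proof -
    have "nrm (P A x) \<le> (\<Sum>n\<in>A. nrm (e\<^sup>* n x *s e n))"
      unfolding P_def by (intro nrm_sum_le carrier_scale basis_in)
    also have "\<dots> \<le> (\<Sum>n\<in>A. (\<kappa> * nrm x) * \<kappa>)"
      using \<kappa> that nrm_nonneg
      by (intro sum_mono) (auto simp: nrm_scale basis_in intro!: mult_mono mult_nonneg_nonneg)
    also have "\<dots> = real (card A) * (\<kappa>\<^sup>2 * nrm x)"
      by (simp add: power2_eq_square mult_ac)
    also have "\<dots> \<le> real N * (\<kappa>\<^sup>2 * nrm x)"
      using that nrm_nonneg by (intro mult_right_mono) auto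
    finally show ?thesis by (simp add: mult_ac)
  qed
  then show thesis
    using that[of "real N * \<kappa>\<^sup>2"] by simp
qed

lemma nrm_diff_P_le:
  obtains K where "0 \<le> K"
    "\<And>A x. finite A \<Longrightarrow> card A \<le> N \<Longrightarrow> x \<in> X \<Longrightarrow> nrm (x - P A x) \<le> K * nrm x"
proof -
  obtain K where K: "0 \<le> K"
    "\<And>A x. finite A \<Longrightarrow> card A \<le> N \<Longrightarrow> x \<in> X \<Longrightarrow> nrm (P A x) \<le> K * nrm x"
    using nrm_P_le[of N] by metis
  have "nrm (x - P A x) \<le> (1 + K) * nrm x" if "finite A" "card A \<le> N" "x \<in> X" for A x
    using nrm_diff_le[OF that(3) P_in, of A x] K(2)[OF that] by (simp add: algebra_simps)
  then show thesis
    using that[of "1 + K"] K(1) by simp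
qed

lemma nrm_pos: "x \<in> X \<Longrightarrow> x \<noteq> 0 \<Longrightarrow> 0 < nrm x"
  using nrm_nonneg nrm_eq_zero by (metis order_le_less)

lemma g_tilde_finite: "g_tilde N < top"
proof -
  obtain K where K: "0 \<le> K"
    "\<And>A x. finite A \<Longrightarrow> card A \<le> N \<Longrightarrow> x \<in> X \<Longrightarrow> nrm (P A x) \<le> K * nrm x"
    using nrm_P_le[of N] by metis
  have "g_tilde N \<le> ennreal (2 * K)"
    unfolding g_tilde_def
  proof (rule Sup_least, elim CollectE exE conjE)
    fix r x \<Gamma> \<Gamma>' k m
    assume r: "r = ennreal (nrm (P \<Gamma> x - P \<Gamma>' x) / nrm x)"
      and *: "x \<in> X" "x \<noteq> 0" "\<Gamma> \<in> greedy_sets x k" "\<Gamma>' \<in> greedy_sets x m" "m < k" "k \<le> N"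
    have "nrm (P \<Gamma> x - P \<Gamma>' x) \<le> nrm (P \<Gamma> x) + nrm (P \<Gamma>' x)"
      by (intro nrm_diff_le P_in)
    also have "\<dots> \<le> K * nrm x + K * nrm x"
      using * by (intro add_mono K(2)) (auto dest: greedy_setsD)
    finally show "r \<le> ennreal (2 * K)"
      unfolding r using nrm_pos[OF *(1,2)] by (intro ennreal_leI) (simp add: field_simps)
  qed
  also have "\<dots> < top" by simp
  finally show ?thesis .
qed

lemma gc_finite: "gc N < top"
proof -
  obtain K where K: "0 \<le> K"
    "\<And>A x. finite A \<Longrightarrow> card A \<le> N \<Longrightarrow> x \<in> X \<Longrightarrow> nrm (x - P A x) \<le> K * nrm x"
    using nrm_diff_P_le[of N] by metis
  have "gc N \<le> ennreal K"
    unfolding gc_def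
  proof (safe intro!: Sup_least ennreal_leI)
    fix x \<Gamma> k
    assume *: "x \<in> X" "x \<noteq> 0" "\<Gamma> \<in> greedy_sets x k" "k \<le> N"
    then show "nrm (x - P \<Gamma> x) / nrm x \<le> K"
      using nrm_pos[OF *(1,2)] K(2)[of \<Gamma> x] by (auto dest: greedy_setsD simp: field_simps)
  qed
  also have "\<dots> < top" by simp
  finally show ?thesis .
qed

lemma kc_finite: "kc N < top"
proof -
  obtain K where K: "0 \<le> K"
    "\<And>A x. finite A \<Longrightarrow> card A \<le> N \<Longrightarrow> x \<in> X \<Longrightarrow> nrm (x - P A x) \<le> K * nrm x"
    using nrm_diff_P_le[of N] by metis
  have "kc N \<le> ennreal K"
    unfolding kc_def op_norm_def
  proof (safe intro!: SUP_least ennreal_leI)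
    fix A :: "nat set" and x
    assume *: "finite A" "card A \<le> N" "x \<in> X" "nrm x \<le> 1"
    then have "nrm (x - P A x) \<le> K * nrm x" by (intro K(2))
    also have "\<dots> \<le> K"
      using * K(1) by (simp add: mult_left_le)
    finally show "nrm (x - P A x) \<le> K" .
  qed
  also have "\<dots> < top" by simp
  finally show ?thesis .
qed

lemma nrm_one_vec_pos: "finite B \<Longrightarrow> B \<noteq> {} \<Longrightarrow> \<eta> \<in> Upsilon \<Longrightarrow> 0 < nrm (one_vec \<eta> B)"
proof (rule nrm_pos[OF one_vec_in])
  assume *: "finite B" "B \<noteq> {}" "\<eta> \<in> Upsilon"
  then obtain n where "n \<in> B" by auto
  with * have "norm (e\<^sup>* n (one_vec \<eta> B)) = 1"
    by (simp add: estar_one_vec Upsilon_def)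
  then show "one_vec \<eta> B \<noteq> 0"
    by (auto simp: estar_zero)
qed

text \<open>The numerator has at most N terms of norm at most \<kappa>. The denominator is at least
  1 / \<kappa>, because \<open>e\<^sup>* n\<close> takes a value of modulus 1 on it for n in
  B.\<close>

lemma mu_tilde_finite: "mu_tilde N < top"
proof -
  obtain \<kappa> where \<kappa>: "0 < \<kappa>" "\<And>n. nrm (e n) \<le> \<kappa>"
    "\<And>n x. x \<in> X \<Longrightarrow> norm (e\<^sup>* n x) \<le> \<kappa> * nrm x"
    using system_bound by metis
  have "mu_tilde N \<le> ennreal (real N * \<kappa> * \<kappa>)"
    unfolding mu_tilde_def
  proof (rule Sup_least, elim CollectE exE conjE)
    fix r A B \<epsilon> \<eta>
    assume r: "r = ennreal (nrm (one_vec \<epsilon> A) / nrm (one_vec \<eta> B))"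
      and *: "finite A" "finite B" "A \<noteq> {}" "B \<noteq> {}" "card A = card B" "card B \<le> N"
        "\<epsilon> \<in> Upsilon" "\<eta> \<in> Upsilon"
    have "nrm (one_vec \<epsilon> A) \<le> (\<Sum>n\<in>A. nrm (\<epsilon> n *s e n))"
      unfolding one_vec_def by (intro nrm_sum_le carrier_scale basis_in)
    also have "\<dots> \<le> (\<Sum>n\<in>A. \<kappa>)"
      using \<kappa>(2) * by (intro sum_mono) (auto simp: nrm_scale basis_in Upsilon_def)
    also have "\<dots> \<le> real N * \<kappa>"
      using * \<kappa>(1) by simp
    finally have num: "nrm (one_vec \<epsilon> A) \<le> real N * \<kappa>" .
    from *(4) obtain n where "n \<in> B" by auto
    with * have "1 = norm (e\<^sup>* n (one_vec \<eta> B))"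
      by (simp add: estar_one_vec Upsilon_def)
    also have "\<dots> \<le> \<kappa> * nrm (one_vec \<eta> B)"
      by (intro \<kappa>(3) one_vec_in)
    finally have "real N * \<kappa> * 1 \<le> real N * \<kappa> * (\<kappa> * nrm (one_vec \<eta> B))"
      using \<kappa>(1) by (intro mult_left_mono) auto
    with num show "r \<le> ennreal (real N * \<kappa> * \<kappa>)"
      unfolding r using nrm_one_vec_pos[OF *(2,4,8)]
      by (intro ennreal_leI) (simp add: field_simps)
  qed
  also have "\<dots> < top" by simp
  finally show ?thesis .
qed

section \<open>The constants as factors in real inequalities\<close>

lemma nrm_diff_P_le_gc:
  assumes "gc N = ennreal c" "0 \<le> c" "x \<in> X" "\<Gamma> \<in> greedy_sets x k" "1 \<le> k" "k \<le> N"
  shows "nrm (x - P \<Gamma> x) \<le> c * nrm x"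
proof (cases "x = 0")
  case True
  then show ?thesis by (simp add: P_def estar_zero nrm_zero)
next
  case False
  with assms show ?thesis
    unfolding gc_def by (intro ennreal_Sup_ratio[OF _ assms(1)[unfolded gc_def]] nrm_pos) blast+
qed

lemma nrm_P_diff_le_g_tilde:
  assumes "g_tilde N = ennreal g" "0 \<le> g" "x \<in> X"
    "\<Gamma> \<in> greedy_sets x k" "\<Gamma>' \<in> greedy_sets x m" "\<Gamma>' \<subset> \<Gamma>" "m < k" "k \<le> N"
  shows "nrm (P \<Gamma> x - P \<Gamma>' x) \<le> g * nrm x"
proof (cases "x = 0")
  case True
  then show ?thesis by (simp add: P_def estar_zero nrm_zero)
next
  case False
  with assms show ?thesis
    by (intro ennreal_Sup_ratio[OF _ assms(1)[unfolded g_tilde_def]] nrm_pos) blast+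
qed

lemma nrm_one_vec_le_mu_tilde:
  assumes "mu_tilde N = ennreal \<mu>" "0 \<le> \<mu>" "finite A" "finite B" "A \<noteq> {}" "B \<noteq> {}"
    "card A = card B" "card B \<le> N" "\<epsilon> \<in> Upsilon" "\<eta> \<in> Upsilon"
  shows "nrm (one_vec \<epsilon> A) \<le> \<mu> * nrm (one_vec \<eta> B)"
  using assms
  by (intro ennreal_Sup_ratio[OF _ assms(1)[unfolded mu_tilde_def]] nrm_one_vec_pos) blast+

lemma nrm_diff_P_le_kc:
  assumes "kc N = ennreal c" "0 \<le> c" "x \<in> X" "finite A" "card A \<le> N"
  shows "nrm (x - P A x) \<le> c * nrm x"
proof (cases "x = 0")
  case True
  then show ?thesis by (simp add: P_def estar_zero nrm_zero)
next
  case False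
  then have nx: "0 < nrm x" by (rule nrm_pos[OF assms(3)])
  \<comment> \<open>\<open>op_norm\<close> tests only the unit ball, so x is scaled to norm 1 and
    the scalar is pulled out again by homogeneity.\<close>
  define a :: 'k where "a = of_real (inverse (nrm x))"
  have norm_a: "norm a = inverse (nrm x)"
    using nx unfolding a_def by (simp add: norm_inverse)
  have u: "a *s x \<in> {x \<in> X. nrm x \<le> 1}"
    using nx assms(3) by (auto simp: carrier_scale nrm_scale norm_a)
  have "ennreal (nrm (a *s x - P A (a *s x))) \<le> op_norm (\<lambda>x. x - P A x)"
    unfolding op_norm_def using u by (rule SUP_upper)
  also have "\<dots> \<le> kc N"
    unfolding kc_def using assms by (intro SUP_upper) auto
  finally have "nrm (a *s x - P A (a *s x)) \<le> c"
    using assms(1,2) by (simp add: ennreal_le_iff)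
  moreover have "a *s x - P A (a *s x) = a *s (x - P A x)"
    using assms(3) by (simp add: P_def estar_scale scale_right_diff_distrib scale_sum_right)
  ultimately have "nrm (a *s (x - P A x)) \<le> c"
    by metis
  then have "inverse (nrm x) * nrm (x - P A x) \<le> c"
    using nrm_scale[OF carrier_diff[OF assms(3) P_in], of a A x] norm_a by simp
  then show ?thesis
    using nx by (simp add: field_simps)
qed

section \<open>Sums with unimodular coefficients\<close>

lemma unit_sign_Upsilon: "(\<lambda>n. unit_sign (f n)) \<in> Upsilon"
  by (simp add: Upsilon_def norm_unit_sign)

text \<open>With \<epsilon> the signs of the coefficients, the sum of
  \<open>\<epsilon> n *s e n\<close> over a subset A' of A is the average of two full signed sums,
  one with the signs \<epsilon> and one with \<epsilon> negated off A'. So C bounds all partial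
  sums, and the moduli of the coefficients are weights between 0 and t for
  \<open>nrm_weighted_sum_le\<close>. The argument is the same for real and complex scalars.\<close>

lemma nrm_comb_le_signs:
  assumes "finite A" "0 \<le> t" "\<And>n. n \<in> A \<Longrightarrow> norm (a n) \<le> t"
    and C: "\<And>\<epsilon>. \<epsilon> \<in> Upsilon \<Longrightarrow> nrm (one_vec \<epsilon> A) \<le> C"
  shows "nrm (\<Sum>n\<in>A. a n *s e n) \<le> t * C"
proof -
  define \<epsilon> where "\<epsilon> = (\<lambda>n. unit_sign (a n))"
  have \<epsilon>: "\<epsilon> \<in> Upsilon"
    unfolding \<epsilon>_def by (rule unit_sign_Upsilon)
  have sub: "nrm (\<Sum>n\<in>A'. \<epsilon> n *s e n) \<le> C" if "A' \<subseteq> A" for A'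
  proof -
    define \<eta> where "\<eta> = (\<lambda>n. if n \<in> A' then \<epsilon> n else - \<epsilon> n)"
    have \<eta>: "\<eta> \<in> Upsilon"
      using \<epsilon> by (auto simp: \<eta>_def Upsilon_def)
    have "one_vec \<epsilon> A + one_vec \<eta> A = (\<Sum>n\<in>A. (\<epsilon> n + \<eta> n) *s e n)"
      by (simp add: one_vec_def sum.distrib scale_left_distrib)
    also have "\<dots> = (\<Sum>n\<in>A. if n \<in> A' then 2 *s \<epsilon> n *s e n else 0)"
    proof (intro sum.cong refl)
      show "(\<epsilon> n + \<eta> n) *s e n = (if n \<in> A' then 2 *s \<epsilon> n *s e n else 0)" for n
        unfolding \<eta>_def scale_scale
        by (cases "n \<in> A'") (simp_all only: mult_2 if_True if_False right_minus scale_zero_left)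
    qed
    also have "\<dots> = 2 *s (\<Sum>n\<in>A'. \<epsilon> n *s e n)"
      using that \<open>finite A\<close>
      by (simp add: sum.If_cases Int_absorb1 scale_sum_right)
    finally have "2 * nrm (\<Sum>n\<in>A'. \<epsilon> n *s e n) = nrm (one_vec \<epsilon> A + one_vec \<eta> A)"
      by (simp add: nrm_scale comb_in del: scale_scale)
    also have "\<dots> \<le> nrm (one_vec \<epsilon> A) + nrm (one_vec \<eta> A)"
      by (intro nrm_triangle one_vec_in)
    also have "\<dots> \<le> C + C"
      by (intro add_mono C \<epsilon> \<eta>)
    finally show ?thesis by simp
  qed
  have "nrm (\<Sum>n\<in>A. of_real (norm (a n)) *s \<epsilon> n *s e n) \<le> t * C"
    using assms(1-3) by (intro nrm_weighted_sum_le sub) (auto intro!: carrier_intros basis_in)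
  moreover have "of_real (norm (a n)) * \<epsilon> n = a n" for n
    by (simp add: \<epsilon>_def norm_mult_unit_sign)
  ultimately show ?thesis by simp
qed

text \<open>
  The superlevel sets of the weights \<open>t / |e\<^sup>* n y|\<close> are complements, inside \<open>B\<close>, of greedy sets.
\<close>

lemma nrm_one_vec_greedy_le:
  assumes g: "g_tilde N = ennreal g" "0 \<le> g"
    and y: "y \<in> X" and B: "B \<in> greedy_sets y k" and "k \<le> N"
    and "0 \<le> t" and t: "\<And>n. n \<in> B \<Longrightarrow> t \<le> norm (e\<^sup>* n y)"
  shows "t * nrm (one_vec (\<lambda>n. unit_sign (e\<^sup>* n y)) B) \<le> g * nrm y"
proof (cases "t = 0")
  case True
  then show ?thesis using g nrm_nonneg[OF y] by simp
next
  case False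
  with \<open>0 \<le> t\<close> have "0 < t" by simp
  note Bf = greedy_setsD[OF B]
  have pos: "0 < norm (e\<^sup>* n y)" if "n \<in> B" for n
    using t[OF that] \<open>0 < t\<close> by linarith
  \<comment> \<open>On B these weights are at most 1 by the choice of t, and they turn the term of
    \<open>P B y\<close> at n into t times the sign of its coefficient.\<close>
  define w where "w = (\<lambda>n. t / norm (e\<^sup>* n y))"
  have level: "nrm (\<Sum>n\<in>{n \<in> B. s \<le> w n}. e\<^sup>* n y *s e n) \<le> g * nrm y" if "0 < s" for s
  proof -
    define B' where "B' = {n \<in> B. w n < s}"
    have fB': "finite B'" "B' \<subseteq> B" using Bf(1) by (auto simp: B'_def)
    have split: "(\<Sum>n\<in>{n \<in> B. s \<le> w n}. e\<^sup>* n y *s e n) = P B y - P B' y"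
    proof -
      have eq: "{n \<in> B. s \<le> w n} = B - B'" by (auto simp: B'_def)
      show ?thesis unfolding P_def eq using Bf(1) fB'(2) by (rule sum_diff)
    qed
    \<comment> \<open>\<open>g_tilde\<close> compares a greedy set with a proper subset, so B' = B
      is treated apart; the superlevel set is then empty.\<close>
    show ?thesis
    proof (cases "B' = B")
      case True
      then show ?thesis
        using split g nrm_nonneg[OF y] by (simp add: nrm_zero)
    next
      case False
      with fB' have psub: "B' \<subset> B" by auto
      \<comment> \<open>Inside B a smaller weight means a larger coefficient; outside B the
        greediness of B decides.\<close>
      have "norm (e\<^sup>* m y) \<le> norm (e\<^sup>* n y)" if nm: "n \<in> B'" "m \<notin> B'" for n m
      proof (cases "m \<in> B")
        case True
        with nm have "w n \<le> w m" "n \<in> B" by (auto simp: B'_def)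
        then show ?thesis
          using pos[OF True] pos[of n] \<open>0 < t\<close> by (simp add: w_def field_simps)
      qed (use nm Bf(3) fB' in blast)
      then have "B' \<in> greedy_sets y (card B')"
        using fB' by (auto simp: greedy_sets_def)
      then have "nrm (P B y - P B' y) \<le> g * nrm y"
        using psubset_card_mono[OF Bf(1) psub] Bf(2) \<open>k \<le> N\<close> psub
        by (intro nrm_P_diff_le_g_tilde[OF g y B]) auto
      then show ?thesis using split by simp
    qed
  qed
  have "nrm (\<Sum>n\<in>B. of_real (w n) *s e\<^sup>* n y *s e n) \<le> 1 * (g * nrm y)"
    using Bf(1) t pos \<open>0 < t\<close>
    by (intro nrm_weighted_sum_le level) (auto simp: w_def intro!: carrier_intros basis_in)
  moreover have "(\<Sum>n\<in>B. of_real (w n) *s e\<^sup>* n y *s e n)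
      = of_real t *s one_vec (\<lambda>n. unit_sign (e\<^sup>* n y)) B"
    unfolding one_vec_def scale_sum_right
    using pos by (intro sum.cong) (auto simp: w_def unit_sign_def)
  ultimately show ?thesis
    using \<open>0 < t\<close> by (simp add: nrm_scale one_vec_in)
qed

text \<open>
  Since \<open>y\<close> may have large coefficients on \<open>A\<close>, the set \<open>\<Gamma> - A\<close> need not be greedy for \<open>y\<close>;
  it is replaced by a greedy set \<open>B\<close> for \<open>y\<close> with as many elements as \<open>A - \<Gamma>\<close>.
\<close>

lemma nrm_P_diff_set_le:
  assumes g: "g_tilde N = ennreal g" "0 \<le> g" and \<mu>: "mu_tilde N = ennreal \<mu>" "0 \<le> \<mu>"
    and \<Gamma>: "\<Gamma> \<in> greedy_sets x N" and A: "finite A" "card A \<le> N"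
    and y: "y \<in> X" and off: "\<And>n. n \<notin> A \<Longrightarrow> e\<^sup>* n y = e\<^sup>* n x"
  shows "nrm (P (A - \<Gamma>) x) \<le> g * \<mu> * nrm y"
proof (cases "A - \<Gamma> = {}")
  case True
  show ?thesis unfolding True using g \<mu> nrm_nonneg[OF y] by (simp add: P_empty nrm_zero)
next
  case ne: False
  note \<Gamma>f = greedy_setsD[OF \<Gamma>]
  define k where "k = card (A - \<Gamma>)"
  have kN: "k \<le> N"
    using A card_mono[of A "A - \<Gamma>"] unfolding k_def by auto
  \<comment> \<open>Both sides lose the same intersection, and A has at most N elements while
    \<Gamma> has exactly N.\<close>
  have "card (A - \<Gamma>) \<le> card (\<Gamma> - A)"
    using A \<Gamma>f(1,2) card_Int_Diff[of A \<Gamma>] card_Int_Diff[of \<Gamma> A] by (simp add: Int_commute)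
  then have k_le: "k \<le> card (\<Gamma> - A)" by (simp add: k_def)
  have "0 < k" using ne A unfolding k_def by (simp add: card_gt_0_iff)
  obtain B where B: "B \<in> greedy_sets y k"
    using greedy_sets_nonempty[OF y] by blast
  note Bf = greedy_setsD[OF B]
  have "B \<noteq> {}" using Bf(2) \<open>0 < k\<close> by auto
  define t where "t = Min ((\<lambda>n. norm (e\<^sup>* n y)) ` B)"
  have t_le: "t \<le> norm (e\<^sup>* n y)" if "n \<in> B" for n
    using that Bf(1) unfolding t_def by simp
  have "t \<in> (\<lambda>n. norm (e\<^sup>* n y)) ` B"
    unfolding t_def using Bf(1) \<open>B \<noteq> {}\<close> by (intro Min_in) auto
  then obtain b where b: "b \<in> B" "norm (e\<^sup>* b y) = t" by auto
  then have "0 \<le> t" by auto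
  \<comment> \<open>Some index of \<Gamma> - A has a coefficient of y of modulus at most t: either b
    itself, or an index outside B, which exists because otherwise \<Gamma> - A would be a subset of
    B missing b, hence of size below k. There x and y have the same coefficient, so greediness of
    \<Gamma> for x bounds the coefficients of x outside \<Gamma> by t.\<close>
  have small: "norm (e\<^sup>* n x) \<le> t" if n: "n \<in> A - \<Gamma>" for n
  proof (cases "b \<in> \<Gamma> - A")
    case True
    then show ?thesis using n \<Gamma>f(3)[of b n] b(2) off[of b] by auto
  next
    case False
    have "\<not> \<Gamma> - A \<subseteq> B"
    proof
      assume "\<Gamma> - A \<subseteq> B"
      with False b(1) have "\<Gamma> - A \<subset> B" by blast
      then have "card (\<Gamma> - A) < k"
        using psubset_card_mono[OF Bf(1)] Bf(2) by blast
      with k_le show False by simp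
    qed
    then obtain c where c: "c \<in> \<Gamma>" "c \<notin> A" "c \<notin> B" by blast
    then have "norm (e\<^sup>* n x) \<le> norm (e\<^sup>* c y)"
      using n \<Gamma>f(3)[of c n] off[of c] by auto
    also have "\<dots> \<le> t" using Bf(3)[OF b(1) c(3)] b(2) by simp
    finally show ?thesis .
  qed
  define \<eta> where "\<eta> = (\<lambda>n. unit_sign (e\<^sup>* n y))"
  \<comment> \<open>\<open>mu_tilde\<close> bounds every choice of signs on A - \<Gamma> by the one
    fixed choice \<eta> on B, where the signs are those of y, as the greedy estimate
    requires.\<close>
  have "nrm (P (A - \<Gamma>) x) \<le> t * (\<mu> * nrm (one_vec \<eta> B))"
    unfolding P_def
    using A ne Bf \<open>B \<noteq> {}\<close> kN small \<open>0 \<le> t\<close>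
    by (intro nrm_comb_le_signs nrm_one_vec_le_mu_tilde[OF \<mu>])
       (auto simp: k_def \<eta>_def unit_sign_Upsilon)
  also have "\<dots> = \<mu> * (t * nrm (one_vec \<eta> B))"
    by simp
  also have "\<dots> \<le> \<mu> * (g * nrm y)"
    using nrm_one_vec_greedy_le[OF g y B kN \<open>0 \<le> t\<close> t_le] \<mu>(2)
    unfolding \<eta>_def by (intro mult_left_mono) auto
  finally show ?thesis by (simp add: mult_ac)
qed

section \<open>The upper bounds for \<open>L\<close> and \<open>L_tilde\<close>\<close>

lemma diff_P_greedy_split:
  assumes x: "x \<in> X" and fin: "finite \<Gamma>" "finite A"
  shows "x - P \<Gamma> x = (x - P (A \<union> \<Gamma>) x) + P (A - \<Gamma>) x"
proof -
  have "P (\<Gamma> \<union> (A - \<Gamma>)) x = P \<Gamma> x + P (A - \<Gamma>) x"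
    using fin by (intro P_disjoint_union) auto
  moreover have "\<Gamma> \<union> (A - \<Gamma>) = A \<union> \<Gamma>" by auto
  ultimately show ?thesis by simp
qed

text \<open>The projection onto A \<union> \<Gamma> fixes z, so x and y = x - z leave the same
  remainder there. That set has at most 2 * N elements, which is where \<open>kc (2 * N)\<close>
  comes from. The other summand is bounded by \<open>nrm_P_diff_set_le\<close>, as x and y agree off
  A.\<close>

lemma L_le: "L N \<le> kc (2 * N) + g_tilde N * mu_tilde N"
proof -
  obtain c where c: "kc (2 * N) = ennreal c" "0 \<le> c"
    using ennreal_real_obtain[OF kc_finite] by blast
  obtain g where g: "g_tilde N = ennreal g" "0 \<le> g"
    using ennreal_real_obtain[OF g_tilde_finite] by blast
  obtain \<mu> where \<mu>: "mu_tilde N = ennreal \<mu>" "0 \<le> \<mu>"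
    using ennreal_real_obtain[OF mu_tilde_finite] by blast
  have C: "kc (2 * N) + g_tilde N * mu_tilde N = ennreal (c + g * \<mu>)"
    using c g \<mu> by (simp add: ennreal_mult ennreal_plus)
  have "ennreal (nrm (x - G x)) \<le> ennreal (c + g * \<mu>) * sigma N x"
    if x: "x \<in> X" and G: "G \<in> greedy_operators N" for x G
    unfolding sigma_def
  proof (rule ennreal_le_mult_INF)
    show "Sigma_N N \<noteq> {}"
      unfolding Sigma_N_def by (auto intro!: exI[of _ "{}"])
  next
    obtain \<Gamma> where \<Gamma>: "\<Gamma> \<in> greedy_sets x N" "G x = P \<Gamma> x"
      using x G by (auto simp: greedy_operators_def)
    note \<Gamma>f = greedy_setsD[OF \<Gamma>(1)]
    fix z assume "z \<in> Sigma_N N"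
    then obtain A a where A: "finite A" "card A \<le> N" and z: "z = (\<Sum>n\<in>A. a n *s e n)"
      by (auto simp: Sigma_N_def)
    have zX: "z \<in> X" unfolding z by (rule comb_in)
    define y where "y = x - z"
    have y: "y \<in> X" unfolding y_def using x zX by (rule carrier_diff)
    have off: "e\<^sup>* n y = e\<^sup>* n x" if "n \<notin> A" for n
      using that A x zX by (simp add: y_def estar_diff z estar_comb)
    have P_z: "P (A \<union> \<Gamma>) z = z"
    proof -
      have "P (A \<union> \<Gamma>) z = (\<Sum>n\<in>A. e\<^sup>* n z *s e n)"
        unfolding P_def using A \<Gamma>f(1) by (intro sum.mono_neutral_right) (auto simp: z estar_comb)
      also have "\<dots> = z"
        using A by (simp add: z estar_comb)
      finally show ?thesis .
    qed
    have "P (A \<union> \<Gamma>) y = P (A \<union> \<Gamma>) x - P (A \<union> \<Gamma>) z"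
      by (simp add: P_def y_def estar_diff x zX scale_left_diff_distrib sum_subtractf)
    then have eq: "x - P (A \<union> \<Gamma>) x = y - P (A \<union> \<Gamma>) y"
      by (simp add: P_z y_def)
    have "nrm (x - P \<Gamma> x) \<le> nrm (x - P (A \<union> \<Gamma>) x) + nrm (P (A - \<Gamma>) x)"
      unfolding diff_P_greedy_split[OF x \<Gamma>f(1) A(1)]
      by (intro nrm_triangle carrier_diff P_in x)
    also have "\<dots> \<le> c * nrm y + g * \<mu> * nrm y"
    proof (rule add_mono)
      show "nrm (x - P (A \<union> \<Gamma>) x) \<le> c * nrm y"
        unfolding eq using A \<Gamma>f card_Un_le[of A \<Gamma>]
        by (intro nrm_diff_P_le_kc[OF c] y) auto
      show "nrm (P (A - \<Gamma>) x) \<le> g * \<mu> * nrm y"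
        by (rule nrm_P_diff_set_le[OF g \<mu> \<Gamma>(1) A y off])
    qed
    finally have "nrm (x - G x) \<le> (c + g * \<mu>) * nrm y"
      by (simp add: \<Gamma>(2) algebra_simps)
    then show "ennreal (nrm (x - G x)) \<le> ennreal (c + g * \<mu>) * ennreal (nrm (x - z))"
      unfolding y_def[symmetric]
      using c(2) g(2) \<mu>(2) nrm_nonneg[OF y] by (intro ennreal_le_mult) simp_all
  qed simp
  then show ?thesis
    unfolding L_def C by (intro Inf_lower) auto
qed

text \<open>Together with \<open>one_le_mu_tilde\<close> this settles the case
  \<open>\<Gamma> \<subseteq> A\<close> of \<open>L_tilde_le\<close>. The witness is
  \<open>e 0\<close> with its greedy sets {0} and {}.\<close>

lemma one_le_g_tilde: "1 \<le> N \<Longrightarrow> 1 \<le> g_tilde N"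
proof -
  assume "1 \<le> N"
  have "{0} \<in> greedy_sets (e 0) 1" "{} \<in> greedy_sets (e 0) 0"
    by (auto simp: greedy_sets_def biorthogonal)
  then have "ennreal (nrm (P {0} (e 0) - P {} (e 0)) / nrm (e 0)) \<le> g_tilde N"
    unfolding g_tilde_def using \<open>1 \<le> N\<close> basis_in[of 0] basis_nonzero[of 0]
    by (intro Sup_upper CollectI exI[of _ "e 0"] exI[of _ "{0}"] exI[of _ "{}"]
        exI[of _ 1] exI[of _ 0]) auto
  then show ?thesis
    using nrm_pos[OF basis_in basis_nonzero, of 0] by (simp add: P_def biorthogonal)
qed

lemma one_le_mu_tilde: "1 \<le> N \<Longrightarrow> 1 \<le> mu_tilde N"
proof -
  assume "1 \<le> N"
  have U: "(\<lambda>_. 1) \<in> Upsilon" by (simp add: Upsilon_def)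
  have "ennreal (nrm (one_vec (\<lambda>_. 1) {0}) / nrm (one_vec (\<lambda>_. 1) {0})) \<le> mu_tilde N"
    unfolding mu_tilde_def using \<open>1 \<le> N\<close> U
    by (intro Sup_upper CollectI exI[of _ "{0}"] exI[of _ "\<lambda>_. 1"]) auto
  then show ?thesis
    using nrm_pos[OF basis_in basis_nonzero, of 0] by (simp add: one_vec_def)
qed

text \<open>For approximants \<open>P A x\<close> the difference y vanishes on A and agrees with x
  elsewhere. Hence \<Gamma> - A is greedy for y, and the remainder of x off A \<union> \<Gamma> is a
  greedy remainder of y, so \<open>gc\<close> takes the place of \<open>kc\<close>.\<close>

lemma L_tilde_le:
  assumes "1 \<le> N"
  shows "L_tilde N \<le> gc N + g_tilde N * mu_tilde N"
proof -
  obtain c where c: "gc N = ennreal c" "0 \<le> c"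
    using ennreal_real_obtain[OF gc_finite] by blast
  obtain g where g: "g_tilde N = ennreal g" "0 \<le> g"
    using ennreal_real_obtain[OF g_tilde_finite] by blast
  obtain \<mu> where \<mu>: "mu_tilde N = ennreal \<mu>" "0 \<le> \<mu>"
    using ennreal_real_obtain[OF mu_tilde_finite] by blast
  have "1 \<le> g" "1 \<le> \<mu>"
    using one_le_g_tilde[OF assms] one_le_mu_tilde[OF assms] g \<mu> by (simp_all add: ennreal_ge_1)
  then have "1 \<le> g * \<mu>"
    using mult_mono[of 1 g 1 \<mu>] by simp
  have C: "gc N + g_tilde N * mu_tilde N = ennreal (c + g * \<mu>)"
    using c g \<mu> by (simp add: ennreal_mult ennreal_plus)
  have "ennreal (nrm (x - G x)) \<le> ennreal (c + g * \<mu>) * sigma_tilde N x"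
    if x: "x \<in> X" and G: "G \<in> greedy_operators N" for x G
    unfolding sigma_tilde_def
  proof (rule ennreal_le_mult_INF)
    show "{A::nat set. finite A \<and> card A \<le> N} \<noteq> {}"
      by (auto intro!: exI[of _ "{}"])
  next
    obtain \<Gamma> where \<Gamma>: "\<Gamma> \<in> greedy_sets x N" "G x = P \<Gamma> x"
      using x G by (auto simp: greedy_operators_def)
    note \<Gamma>f = greedy_setsD[OF \<Gamma>(1)]
    fix A :: "nat set" assume "A \<in> {A. finite A \<and> card A \<le> N}"
    then have A: "finite A" "card A \<le> N" by auto
    define y where "y = x - P A x"
    have y: "y \<in> X" unfolding y_def by (intro carrier_diff x P_in)
    have coeff: "e\<^sup>* n y = (if n \<in> A then 0 else e\<^sup>* n x)" for n
      using A x by (simp add: y_def estar_diff P_in estar_P)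
    have gr: "\<Gamma> - A \<in> greedy_sets y (card (\<Gamma> - A))"
      using \<Gamma>f by (auto simp: greedy_sets_def coeff)
    have "P (A \<union> (\<Gamma> - A)) x = P A x + P (\<Gamma> - A) x"
      using A \<Gamma>f(1) by (intro P_disjoint_union) auto
    moreover have "P (\<Gamma> - A) x = P (\<Gamma> - A) y"
      by (rule P_cong) (simp add: coeff)
    ultimately have eq: "x - P (A \<union> \<Gamma>) x = y - P (\<Gamma> - A) y"
      by (simp add: y_def)
    have "nrm (x - P \<Gamma> x) \<le> (c + g * \<mu>) * nrm y"
    proof (cases "\<Gamma> \<subseteq> A")
      \<comment> \<open>\<open>gc\<close> admits only nonempty greedy sets. If \<Gamma> - A is
        empty, comparing sizes gives \<Gamma> = A, the error is y itself, and
        \<open>1 \<le> g * \<mu>\<close> suffices.\<close>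
      case True
      then have "\<Gamma> = A"
        using A \<Gamma>f(2) by (intro card_seteq) auto
      moreover have "1 * nrm y \<le> (c + g * \<mu>) * nrm y"
        using \<open>1 \<le> g * \<mu>\<close> c(2) nrm_nonneg[OF y] by (intro mult_right_mono) auto
      ultimately show ?thesis by (simp add: y_def)
    next
      case False
      have card: "1 \<le> card (\<Gamma> - A)" "card (\<Gamma> - A) \<le> N"
        using False \<Gamma>f(1,2) card_mono[of \<Gamma> "\<Gamma> - A"]
        by (auto simp: card_gt_0_iff Suc_le_eq)
      have "nrm (x - P \<Gamma> x) \<le> nrm (x - P (A \<union> \<Gamma>) x) + nrm (P (A - \<Gamma>) x)"
        unfolding diff_P_greedy_split[OF x \<Gamma>f(1) A(1)]
        by (intro nrm_triangle carrier_diff P_in x)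
      also have "\<dots> \<le> c * nrm y + g * \<mu> * nrm y"
      proof (rule add_mono)
        show "nrm (x - P (A \<union> \<Gamma>) x) \<le> c * nrm y"
          unfolding eq by (rule nrm_diff_P_le_gc[OF c y gr card])
        show "nrm (P (A - \<Gamma>) x) \<le> g * \<mu> * nrm y"
          by (rule nrm_P_diff_set_le[OF g \<mu> \<Gamma>(1) A y]) (simp add: coeff)
      qed
      finally show ?thesis by (simp add: algebra_simps)
    qed
    then show "ennreal (nrm (x - G x)) \<le> ennreal (c + g * \<mu>) * ennreal (nrm (x - P A x))"
      unfolding y_def[symmetric] \<Gamma>(2)
      using c(2) g(2) \<mu>(2) nrm_nonneg[OF y] by (intro ennreal_le_mult) simp_all
  qed simp
  then show ?thesis
    unfolding L_tilde_def C by (intro Inf_lower) auto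
qed

end

section \<open>The space \<open>\<ell>\<^sub>1 \<oplus>\<^sub>\<infinity> c\<^sub>0\<close>\<close>

text \<open>One family of finite sets encodes both norms: finite sets of even numbers give the sum
  norm, singletons the supremum norm. Norm estimates thereby become termwise estimates of finite
  sums.\<close>

definition mix_sets :: "nat set set" where
  "mix_sets = {F. finite F \<and> (\<forall>n\<in>F. even n)} \<union> range (\<lambda>n. {n})"

text \<open>
  \<open>mix_norm f\<close> is the maximum of the \<open>\<ell>\<^sub>1\<close> norm of \<open>f\<close> on the even numbers and its sup norm;
  \<open>mix_space\<close> is the closure of the finitely supported sequences.
\<close>

definition mix_norm :: "(nat \<Rightarrow> 'k::real_normed_field) \<Rightarrow> real" where
  "mix_norm f = (SUP F\<in>mix_sets. \<Sum>n\<in>F. norm (f n))"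

definition mix_space :: "(nat \<Rightarrow> 'k::real_normed_field) set" where
  "mix_space = {f. \<forall>\<epsilon>>0. \<exists>y. finite {n. y n \<noteq> 0} \<and>
     (\<forall>F\<in>mix_sets. (\<Sum>n\<in>F. norm (f n - y n)) \<le> \<epsilon>)}"

definition mix_scale :: "'k::real_normed_field \<Rightarrow> (nat \<Rightarrow> 'k) \<Rightarrow> nat \<Rightarrow> 'k" where
  "mix_scale c f = (\<lambda>n. c * f n)"

definition mix_basis :: "nat \<Rightarrow> nat \<Rightarrow> 'k::real_normed_field" where
  "mix_basis n = (\<lambda>m. if m = n then 1 else 0)"

lemma mix_sets_finite: "F \<in> mix_sets \<Longrightarrow> finite F"
  by (auto simp: mix_sets_def)

lemma mix_sets_singleton: "{n} \<in> mix_sets"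
  by (auto simp: mix_sets_def)

lemma mix_sets_nonempty: "mix_sets \<noteq> {}"
  using mix_sets_singleton by auto

lemma mix_norm_le: "(\<And>F. F \<in> mix_sets \<Longrightarrow> (\<Sum>n\<in>F. norm (f n)) \<le> c) \<Longrightarrow> mix_norm f \<le> c"
  unfolding mix_norm_def by (intro cSUP_least mix_sets_nonempty)

lemma mix_spaceE:
  assumes "f \<in> mix_space" "0 < \<epsilon>"
  obtains y where "finite {n. y n \<noteq> 0}"
    "\<And>F. F \<in> mix_sets \<Longrightarrow> (\<Sum>n\<in>F. norm (f n - y n)) \<le> \<epsilon>"
  using assms unfolding mix_space_def by blast

text \<open>A real supremum bounds its members only if the family is bounded above. Here a bound is
  1 plus the total sum of a finitely supported approximant within distance 1 of f.\<close>

lemma sum_le_mix_norm: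
  assumes "f \<in> mix_space" "F \<in> mix_sets"
  shows "(\<Sum>n\<in>F. norm (f n)) \<le> mix_norm f"
proof -
  obtain y where fin: "finite {n. y n \<noteq> 0}"
    and y: "\<And>F. F \<in> mix_sets \<Longrightarrow> (\<Sum>n\<in>F. norm (f n - y n)) \<le> 1"
    using assms(1) by (rule mix_spaceE[OF _ zero_less_one]) blast
  have "(\<Sum>n\<in>F. norm (f n)) \<le> 1 + (\<Sum>n\<in>{n. y n \<noteq> 0}. norm (y n))" if F: "F \<in> mix_sets" for F
  proof -
    note finF = mix_sets_finite[OF F]
    have "(\<Sum>n\<in>F. norm (f n)) \<le> (\<Sum>n\<in>F. norm (f n - y n) + norm (y n))"
    proof (rule sum_mono)
      show "norm (f n) \<le> norm (f n - y n) + norm (y n)" for n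
        using norm_triangle_ineq[of "f n - y n" "y n"] by simp
    qed
    also have "\<dots> = (\<Sum>n\<in>F. norm (f n - y n)) + (\<Sum>n\<in>F. norm (y n))"
      by (rule sum.distrib)
    also have "(\<Sum>n\<in>F. norm (y n)) = (\<Sum>n\<in>F \<inter> {n. y n \<noteq> 0}. norm (y n))"
      using finF by (intro sum.mono_neutral_right) auto
    also have "\<dots> \<le> (\<Sum>n\<in>{n. y n \<noteq> 0}. norm (y n))"
      using fin by (intro sum_mono2) auto
    finally show ?thesis using y[OF F] by linarith
  qed
  then have "bdd_above ((\<lambda>F. \<Sum>n\<in>F. norm (f n)) ` mix_sets)"
    by (rule bdd_aboveI2)
  with assms(2) show ?thesis
    unfolding mix_norm_def by (intro cSUP_upper)
qed

lemma norm_le_mix_norm: "f \<in> mix_space \<Longrightarrow> norm (f n) \<le> mix_norm f"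
  using sum_le_mix_norm[OF _ mix_sets_singleton[of n], of f] by simp

lemma mix_norm_nonneg: "f \<in> mix_space \<Longrightarrow> 0 \<le> mix_norm f"
  using norm_le_mix_norm[of f 0] norm_ge_zero[of "f 0"] by linarith

text \<open>This monotonicity in the moduli of the coordinates makes coordinate projections
  contractive.\<close>

lemma mix_norm_mono:
  assumes "f \<in> mix_space" "\<And>n. norm (g n) \<le> norm (f n)"
  shows "mix_norm g \<le> mix_norm f"
proof (rule mix_norm_le)
  fix F assume "F \<in> mix_sets"
  have "(\<Sum>n\<in>F. norm (g n)) \<le> (\<Sum>n\<in>F. norm (f n))"
    by (intro sum_mono assms(2))
  also have "\<dots> \<le> mix_norm f"
    by (rule sum_le_mix_norm) fact+
  finally show "(\<Sum>n\<in>F. norm (g n)) \<le> mix_norm f" .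
qed

lemma mix_space_finite_support: "finite {n. f n \<noteq> 0} \<Longrightarrow> f \<in> mix_space"
  unfolding mix_space_def by (auto intro!: exI[of _ f])

text \<open>Closedness of \<open>mix_space\<close>, needed to place limits of Cauchy sequences in
  it.\<close>

lemma mix_spaceI:
  assumes "\<And>\<epsilon>. 0 < \<epsilon> \<Longrightarrow> \<exists>y\<in>mix_space. \<forall>F\<in>mix_sets. (\<Sum>n\<in>F. norm (f n - y n)) \<le> \<epsilon>"
  shows "f \<in> mix_space"
  unfolding mix_space_def
proof (intro CollectI allI impI)
  fix \<epsilon> :: real assume "0 < \<epsilon>"
  then have half: "0 < \<epsilon> / 2" by simp
  obtain y where y: "y \<in> mix_space" "\<And>F. F \<in> mix_sets \<Longrightarrow> (\<Sum>n\<in>F. norm (f n - y n)) \<le> \<epsilon> / 2"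
    using assms[OF half] by auto
  obtain z where z: "finite {n. z n \<noteq> 0}"
    "\<And>F. F \<in> mix_sets \<Longrightarrow> (\<Sum>n\<in>F. norm (y n - z n)) \<le> \<epsilon> / 2"
    using y(1) half by (rule mix_spaceE) blast
  have "(\<Sum>n\<in>F. norm (f n - z n)) \<le> \<epsilon>" if F: "F \<in> mix_sets" for F
  proof -
    have "(\<Sum>n\<in>F. norm (f n - z n)) \<le> (\<Sum>n\<in>F. norm (f n - y n) + norm (y n - z n))"
    proof (rule sum_mono)
      show "norm (f n - z n) \<le> norm (f n - y n) + norm (y n - z n)" for n
        using norm_triangle_ineq[of "f n - y n" "y n - z n"] by simp
    qed
    also have "\<dots> \<le> \<epsilon>"
      using y(2)[OF F] z(2)[OF F] by (simp add: sum.distrib)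
    finally show ?thesis .
  qed
  with z(1) show "\<exists>z. finite {n. z n \<noteq> 0} \<and> (\<forall>F\<in>mix_sets. (\<Sum>n\<in>F. norm (f n - z n)) \<le> \<epsilon>)"
    by blast
qed

lemma mix_space_add:
  assumes "f \<in> mix_space" "g \<in> mix_space"
  shows "f + g \<in> mix_space"
  unfolding mix_space_def
proof (intro CollectI allI impI)
  fix \<epsilon> :: real assume "0 < \<epsilon>"
  then have half: "0 < \<epsilon> / 2" by simp
  obtain y where y: "finite {n. y n \<noteq> 0}"
    "\<And>F. F \<in> mix_sets \<Longrightarrow> (\<Sum>n\<in>F. norm (f n - y n)) \<le> \<epsilon> / 2"
    using assms(1) half by (rule mix_spaceE) blast
  obtain z where z: "finite {n. z n \<noteq> 0}"
    "\<And>F. F \<in> mix_sets \<Longrightarrow> (\<Sum>n\<in>F. norm (g n - z n)) \<le> \<epsilon> / 2"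
    using assms(2) half by (rule mix_spaceE) blast
  have "{n. (y + z) n \<noteq> 0} \<subseteq> {n. y n \<noteq> 0} \<union> {n. z n \<noteq> 0}" by auto
  then have fin: "finite {n. (y + z) n \<noteq> 0}"
    using y(1) z(1) by (meson finite_UnI finite_subset)
  have "(\<Sum>n\<in>F. norm ((f + g) n - (y + z) n)) \<le> \<epsilon>" if F: "F \<in> mix_sets" for F
  proof -
    have "(\<Sum>n\<in>F. norm ((f + g) n - (y + z) n)) \<le> (\<Sum>n\<in>F. norm (f n - y n) + norm (g n - z n))"
      by (intro sum_mono) (simp add: norm_diff_triangle_ineq)
    also have "\<dots> \<le> \<epsilon>"
      using y(2)[OF F] z(2)[OF F] by (simp add: sum.distrib)
    finally show ?thesis .
  qed
  with fin show "\<exists>y. finite {n. y n \<noteq> 0} \<and>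
      (\<forall>F\<in>mix_sets. (\<Sum>n\<in>F. norm ((f + g) n - y n)) \<le> \<epsilon>)"
    by blast
qed

lemma sum_norm_mix_scale: "(\<Sum>n\<in>F. norm (mix_scale c f n)) = norm c * (\<Sum>n\<in>F. norm (f n))"
  by (simp add: mix_scale_def norm_mult sum_distrib_left)

lemma mix_space_scale:
  assumes "f \<in> mix_space"
  shows "mix_scale c f \<in> mix_space"
proof (cases "c = 0")
  case True
  then show ?thesis by (intro mix_space_finite_support) (simp add: mix_scale_def)
next
  case False
  show ?thesis
    unfolding mix_space_def
  proof (intro CollectI allI impI)
    fix \<epsilon> :: real assume "0 < \<epsilon>"
    then have pos: "0 < \<epsilon> / norm c" using False by simp
    obtain y where y: "finite {n. y n \<noteq> 0}"
      "\<And>F. F \<in> mix_sets \<Longrightarrow> (\<Sum>n\<in>F. norm (f n - y n)) \<le> \<epsilon> / norm c"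
      using assms pos by (rule mix_spaceE) blast
    have "(\<Sum>n\<in>F. norm (mix_scale c f n - mix_scale c y n)) \<le> \<epsilon>" if F: "F \<in> mix_sets" for F
    proof -
      have "(\<Sum>n\<in>F. norm (mix_scale c f n - mix_scale c y n))
          = norm c * (\<Sum>n\<in>F. norm (f n - y n))"
        by (simp add: mix_scale_def right_diff_distrib[symmetric] norm_mult sum_distrib_left)
      also have "\<dots> \<le> \<epsilon>"
        using y(2)[OF F] False by (simp add: field_simps)
      finally show ?thesis .
    qed
    moreover have "finite {n. mix_scale c y n \<noteq> 0}"
      using y(1) False by (simp add: mix_scale_def)
    ultimately show "\<exists>y. finite {n. y n \<noteq> 0} \<and>
        (\<forall>F\<in>mix_sets. (\<Sum>n\<in>F. norm (mix_scale c f n - y n)) \<le> \<epsilon>)"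
      by blast
  qed
qed

lemma mix_norm_scale_le: "f \<in> mix_space \<Longrightarrow> mix_norm (mix_scale c f) \<le> norm c * mix_norm f"
  by (intro mix_norm_le) (simp add: sum_norm_mix_scale sum_le_mix_norm mult_left_mono)

lemma mix_norm_scale:
  assumes f: "f \<in> mix_space"
  shows "mix_norm (mix_scale c f) = norm c * mix_norm f"
proof (rule antisym[OF mix_norm_scale_le[OF f]])
  \<comment> \<open>The converse is the first inequality applied to the inverse scalar.\<close>
  show "norm c * mix_norm f \<le> mix_norm (mix_scale c f)"
  proof (cases "c = 0")
    case True
    then show ?thesis using mix_norm_nonneg[OF mix_space_scale[OF f]] by simp
  next
    case False
    then have "mix_scale (inverse c) (mix_scale c f) = f"
      by (simp add: mix_scale_def mult.assoc[symmetric])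
    then have "mix_norm f \<le> norm (inverse c) * mix_norm (mix_scale c f)"
      using mix_norm_scale_le[OF mix_space_scale[OF f, of c], of "inverse c"] by simp
    then show ?thesis using False by (simp add: norm_divide field_simps)
  qed
qed

lemma mix_norm_triangle:
  assumes "f \<in> mix_space" "g \<in> mix_space"
  shows "mix_norm (f + g) \<le> mix_norm f + mix_norm g"
proof (rule mix_norm_le)
  fix F assume F: "F \<in> mix_sets"
  have "(\<Sum>n\<in>F. norm ((f + g) n)) \<le> (\<Sum>n\<in>F. norm (f n) + norm (g n))"
    by (intro sum_mono) (simp add: norm_triangle_ineq)
  also have "\<dots> \<le> mix_norm f + mix_norm g"
    unfolding sum.distrib by (intro add_mono sum_le_mix_norm assms F)
  finally show "(\<Sum>n\<in>F. norm ((f + g) n)) \<le> mix_norm f + mix_norm g" .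
qed

lemma mix_space_diff: "f \<in> mix_space \<Longrightarrow> g \<in> mix_space \<Longrightarrow> f - g \<in> mix_space"
proof -
  assume "f \<in> mix_space" "g \<in> mix_space"
  then have "f + mix_scale (-1) g \<in> mix_space"
    by (intro mix_space_add mix_space_scale)
  moreover have "f + mix_scale (-1) g = f - g"
    by (simp add: fun_eq_iff mix_scale_def)
  ultimately show ?thesis by simp
qed

text \<open>Coordinates converge because the norm dominates each of them. For a fixed finite F the
  Cauchy estimate survives the limit in m, with a bound independent of F. This uniform bound gives
  both membership of the limit, by closedness, and convergence in norm.\<close>

lemma mix_norm_complete:
  fixes s :: "nat \<Rightarrow> nat \<Rightarrow> 'k::{real_normed_field, banach}"
  assumes s: "\<And>n. s n \<in> mix_space"
    and Cauchy: "\<forall>\<epsilon>>0. \<exists>M. \<forall>m\<ge>M. \<forall>n\<ge>M. mix_norm (s m - s n) < \<epsilon>"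
  shows "\<exists>l\<in>mix_space. (\<lambda>n. mix_norm (s n - l)) \<longlonglongrightarrow> 0"
proof -
  have "Cauchy (\<lambda>n. s n k)" for k
  proof (rule CauchyI)
    fix \<epsilon> :: real assume "0 < \<epsilon>"
    then obtain M where M: "\<And>m n. M \<le> m \<Longrightarrow> M \<le> n \<Longrightarrow> mix_norm (s m - s n) < \<epsilon>"
      using Cauchy by blast
    have "norm (s m k - s n k) < \<epsilon>" if "M \<le> m" "M \<le> n" for m n
      using norm_le_mix_norm[OF mix_space_diff[OF s s], of m n k] M[OF that] by simp
    then show "\<exists>M. \<forall>m\<ge>M. \<forall>n\<ge>M. norm (s m k - s n k) < \<epsilon>" by blast
  qed
  then have "\<exists>l. (\<lambda>n. s n k) \<longlonglongrightarrow> l" for k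
    using Cauchy_convergent convergent_def by blast
  then obtain l where l: "\<And>k. (\<lambda>n. s n k) \<longlonglongrightarrow> l k"
    by metis
  have approx: "\<exists>M. \<forall>n\<ge>M. \<forall>F\<in>mix_sets. (\<Sum>k\<in>F. norm (l k - s n k)) \<le> \<epsilon>" if "0 < \<epsilon>" for \<epsilon> :: real
  proof -
    obtain M where M: "\<And>m n. M \<le> m \<Longrightarrow> M \<le> n \<Longrightarrow> mix_norm (s m - s n) < \<epsilon>"
      using Cauchy \<open>0 < \<epsilon>\<close> by blast
    have "(\<Sum>k\<in>F. norm (l k - s n k)) \<le> \<epsilon>" if "M \<le> n" and F: "F \<in> mix_sets" for n F
    proof (rule LIMSEQ_le_const2)
      show "(\<lambda>m. \<Sum>k\<in>F. norm (s m k - s n k)) \<longlonglongrightarrow> (\<Sum>k\<in>F. norm (l k - s n k))"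
        by (intro tendsto_intros l)
      have "(\<Sum>k\<in>F. norm (s m k - s n k)) \<le> \<epsilon>" if "M \<le> m" for m
        using sum_le_mix_norm[OF mix_space_diff[OF s s] F, of m n] M[OF that \<open>M \<le> n\<close>] by simp
      then show "\<exists>M. \<forall>m\<ge>M. (\<Sum>k\<in>F. norm (s m k - s n k)) \<le> \<epsilon>" by blast
    qed
    then show ?thesis by blast
  qed
  have lX: "l \<in> mix_space"
  proof (rule mix_spaceI)
    fix \<epsilon> :: real assume "0 < \<epsilon>"
    with approx s show "\<exists>y\<in>mix_space. \<forall>F\<in>mix_sets. (\<Sum>n\<in>F. norm (l n - y n)) \<le> \<epsilon>"
      by blast
  qed
  have "(\<lambda>n. mix_norm (s n - l)) \<longlonglongrightarrow> 0"
  proof (rule LIMSEQ_I)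
    fix \<epsilon> :: real assume "0 < \<epsilon>"
    then have "0 < \<epsilon> / 2" by simp
    then obtain M where M: "\<And>n F. M \<le> n \<Longrightarrow> F \<in> mix_sets \<Longrightarrow> (\<Sum>k\<in>F. norm (l k - s n k)) \<le> \<epsilon> / 2"
      using approx by blast
    have "norm (mix_norm (s n - l) - 0) < \<epsilon>" if "M \<le> n" for n
    proof -
      have "mix_norm (s n - l) \<le> \<epsilon> / 2"
        using M[OF that] by (intro mix_norm_le) (simp add: norm_minus_commute)
      then show ?thesis
        using mix_norm_nonneg[OF mix_space_diff[OF s lX], of n] \<open>0 < \<epsilon>\<close> by simp
    qed
    then show "\<exists>M. \<forall>n\<ge>M. norm (mix_norm (s n - l) - 0) < \<epsilon>" by blast
  qed
  with lX show ?thesis by blast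
qed

section \<open>The example as a Banach space with a seminormalized basis\<close>

lemma mix_vector_space: "vector_space mix_scale"
  by unfold_locales (auto simp: fun_eq_iff mix_scale_def algebra_simps)

lemma mix_banach:
  "banach_space_on mix_scale (mix_space :: (nat \<Rightarrow> 'k::{real_normed_field, banach}) set) mix_norm"
proof -
  interpret vector_space "mix_scale :: 'k \<Rightarrow> _"
    by (rule mix_vector_space)
  show ?thesis
  proof
    show "subspace (mix_space :: (nat \<Rightarrow> 'k) set)"
      by (auto simp: subspace_def mix_space_add mix_space_scale mix_space_finite_support)
  next
    fix f :: "nat \<Rightarrow> 'k" assume f: "f \<in> mix_space"
    show "mix_norm f = 0 \<longleftrightarrow> f = 0"
    proof
      assume "mix_norm f = 0"
      then show "f = 0"
        using norm_le_mix_norm[OF f] by (simp add: fun_eq_iff)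
    next
      assume "f = 0"
      then show "mix_norm f = 0"
        using mix_norm_scale[OF f, of 0] by (simp add: mix_scale_def zero_fun_def)
    qed
  qed (auto simp: mix_norm_nonneg mix_norm_scale mix_norm_triangle intro: mix_norm_complete)
qed

lemma mix_basis_in: "mix_basis n \<in> mix_space"
  by (intro mix_space_finite_support) (simp add: mix_basis_def)

lemma mix_norm_basis: "mix_norm (mix_basis n :: nat \<Rightarrow> 'k::real_normed_field) = 1"
proof (rule antisym)
  show "mix_norm (mix_basis n :: nat \<Rightarrow> 'k) \<le> 1"
  proof (rule mix_norm_le)
    fix F assume "F \<in> mix_sets"
    then have "finite F" by (rule mix_sets_finite)
    then have "(\<Sum>m\<in>F. norm (mix_basis n m :: 'k)) = (if n \<in> F then 1 else 0)"
      unfolding mix_basis_def if_distrib[of norm] norm_one norm_zero by (rule sum.delta)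
    then show "(\<Sum>m\<in>F. norm (mix_basis n m :: 'k)) \<le> 1" by simp
  qed
  show "1 \<le> mix_norm (mix_basis n :: nat \<Rightarrow> 'k)"
    using norm_le_mix_norm[OF mix_basis_in, of n n, where ?'a = 'k] by (simp add: mix_basis_def)
qed

lemma sum_fun_apply: "(\<Sum>i\<in>I. f i) x = (\<Sum>i\<in>I. f i x)"
  by (induction I rule: infinite_finite_induct) auto

lemma finite_support_expansion:
  assumes "finite {n. y n \<noteq> 0}"
  shows "y = (\<Sum>n\<in>{n. y n \<noteq> 0}. mix_scale (y n) (mix_basis n))"
proof
  fix m
  have "(\<Sum>n\<in>{n. y n \<noteq> 0}. mix_scale (y n) (mix_basis n)) m
      = (\<Sum>n\<in>{n. y n \<noteq> 0}. if m = n then y n else 0)"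
    unfolding sum_fun_apply by (intro sum.cong) (auto simp: mix_scale_def mix_basis_def)
  also have "\<dots> = y m"
    using assms by simp
  finally show "y m = (\<Sum>n\<in>{n. y n \<noteq> 0}. mix_scale (y n) (mix_basis n)) m" by simp
qed

lemma mix_system:
  "seminormalized_system mix_scale
     (mix_space :: (nat \<Rightarrow> 'k::{real_normed_field, banach}) set) mix_norm mix_basis (\<lambda>n f. f n)"
proof -
  interpret banach_space_on mix_scale "mix_space :: (nat \<Rightarrow> 'k) set" mix_norm
    by (rule mix_banach)
  show ?thesis
  proof
    fix f :: "nat \<Rightarrow> 'k" and \<epsilon> :: real
    assume f: "f \<in> mix_space" and "0 < \<epsilon>"
    then have half: "0 < \<epsilon> / 2" by simp
    obtain y where y: "finite {n. y n \<noteq> 0}"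
      "\<And>F. F \<in> mix_sets \<Longrightarrow> (\<Sum>n\<in>F. norm (f n - y n)) \<le> \<epsilon> / 2"
      using f half by (rule mix_spaceE) blast
    have "y \<in> span (range mix_basis)"
      by (subst finite_support_expansion[OF y(1)]) (intro span_sum span_scale span_base rangeI)
    moreover have "mix_norm (f - y) \<le> \<epsilon> / 2"
      using y(2) by (intro mix_norm_le) simp
    ultimately show "\<exists>y\<in>span (range mix_basis). mix_norm (f - y) < \<epsilon>"
      using \<open>0 < \<epsilon>\<close> by (intro bexI[of _ y]) auto
  next
    \<comment> \<open>Both constants are 1: evaluation at n is bounded by the norm and attains the
      value 1 at the unit vector \<open>mix_basis n\<close>.\<close>
    have "1 \<le> dual_norm (\<lambda>f. f n)" for n
    proof -
      have "ennreal (norm (mix_basis n n :: 'k)) \<le> dual_norm (\<lambda>f. f n)"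
        unfolding dual_norm_def
        by (rule SUP_upper) (simp add: mix_basis_in mix_norm_basis)
      then show ?thesis by (simp add: mix_basis_def)
    qed
    moreover have "dual_norm (\<lambda>f. f n) \<le> 1" for n
      unfolding dual_norm_def using norm_le_mix_norm order_trans
      by (intro SUP_least) (fastforce simp: ennreal_le_1)
    ultimately show "\<exists>\<kappa>\<^sub>1 \<kappa>\<^sub>2 :: real. 0 < \<kappa>\<^sub>1 \<and>
         (\<forall>n. \<kappa>\<^sub>1 \<le> mix_norm (mix_basis n :: nat \<Rightarrow> 'k) \<and> mix_norm (mix_basis n :: nat \<Rightarrow> 'k) \<le> \<kappa>\<^sub>2 \<and>
              ennreal \<kappa>\<^sub>1 \<le> dual_norm (\<lambda>f. f n) \<and> dual_norm (\<lambda>f. f n) \<le> ennreal \<kappa>\<^sub>2)"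
      by (intro exI[of _ 1]) (simp add: mix_norm_basis)
  qed (rule mix_basis_in | simp add: mix_basis_def mix_scale_def)+
qed

section \<open>Equality in the example\<close>

text \<open>Both right-hand sides are at most 1 + N and both Lebesgue constants are at least 1 + N.
  With the general upper bounds this forces equality, so the other constants need only be bounded
  from above.\<close>

lemma mix_equalities:
  fixes N :: nat
  defines "X \<equiv> mix_space :: (nat \<Rightarrow> 'k::{real_normed_field, banach}) set"
  assumes "1 \<le> N"
  shows "seminormalized_system.L mix_scale X mix_norm mix_basis (\<lambda>n f. f n) N
      = seminormalized_system.kc mix_scale X mix_norm mix_basis (\<lambda>n f. f n) (2 * N)
        + seminormalized_system.g_tilde mix_scale X mix_norm mix_basis (\<lambda>n f. f n) N
          * seminormalized_system.mu_tilde (mix_scale :: 'k \<Rightarrow> _) mix_norm mix_basis N" (is ?L)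
    and "seminormalized_system.L_tilde mix_scale X mix_norm mix_basis (\<lambda>n f. f n) N
      = seminormalized_system.gc mix_scale X mix_norm mix_basis (\<lambda>n f. f n) N
        + seminormalized_system.g_tilde mix_scale X mix_norm mix_basis (\<lambda>n f. f n) N
          * seminormalized_system.mu_tilde (mix_scale :: 'k \<Rightarrow> _) mix_norm mix_basis N" (is ?L_tilde)
proof -
  interpret seminormalized_system mix_scale X mix_norm mix_basis "\<lambda>n f. f n"
    unfolding X_def by (rule mix_system)
  have P_apply: "P A f n = (if n \<in> A then f n else 0)" if "finite A" for A f n
    using estar_P[OF that] .
  have ratio: "ennreal (mix_norm g / mix_norm f) \<le> 1"
    if "f \<in> X" "f \<noteq> 0" "\<And>n. norm (g n) \<le> norm (f n)" for f g
    using mix_norm_mono[of f g] nrm_pos[OF that(1,2)] that unfolding X_def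
    by (simp add: ennreal_le_1)

  have kc_le: "kc M \<le> 1" for M
    unfolding kc_def op_norm_def
  proof (intro SUP_least)
    fix A :: "nat set" and f
    assume "A \<in> {A. finite A \<and> card A \<le> M}" and f: "f \<in> {f \<in> X. mix_norm f \<le> 1}"
    then have "mix_norm (f - P A f) \<le> mix_norm f"
      unfolding X_def by (intro mix_norm_mono) (simp_all add: P_apply)
    with f show "ennreal (mix_norm (f - P A f)) \<le> 1"
      by (simp add: ennreal_le_1)
  qed
  have gc_le: "gc N \<le> 1"
    unfolding gc_def
  proof (rule Sup_least, elim CollectE exE conjE)
    fix r f \<Gamma> k
    assume r: "r = ennreal (mix_norm (f - P \<Gamma> f) / mix_norm f)"
      and *: "f \<in> X" "f \<noteq> 0" "\<Gamma> \<in> greedy_sets f k"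
    show "r \<le> 1"
      unfolding r by (intro ratio *(1,2)) (simp add: P_apply greedy_setsD(1)[OF *(3)])
  qed
  have g_tilde_le: "g_tilde N \<le> 1"
    unfolding g_tilde_def
  proof (rule Sup_least, elim CollectE exE conjE)
    fix r f \<Gamma> \<Gamma>' k m
    assume r: "r = ennreal (mix_norm (P \<Gamma> f - P \<Gamma>' f) / mix_norm f)"
      and *: "f \<in> X" "f \<noteq> 0" "\<Gamma> \<in> greedy_sets f k" "\<Gamma>' \<in> greedy_sets f m"
    show "r \<le> 1"
      unfolding r
      by (intro ratio *(1,2)) (simp add: P_apply greedy_setsD(1)[OF *(3)] greedy_setsD(1)[OF *(4)])
  qed
  \<comment> \<open>The numerator is a sum of at most N vectors of norm 1, and the denominator
    dominates a coordinate of modulus 1.\<close>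
  have mu_tilde_le: "mu_tilde N \<le> ennreal (real N)"
    unfolding mu_tilde_def
  proof (rule Sup_least, elim CollectE exE conjE)
    fix r A B and \<epsilon> \<eta> :: "nat \<Rightarrow> 'k"
    assume r: "r = ennreal (mix_norm (one_vec \<epsilon> A) / mix_norm (one_vec \<eta> B))"
      and *: "finite A" "finite B" "B \<noteq> {}" "card A = card B" "card B \<le> N"
        "\<epsilon> \<in> Upsilon" "\<eta> \<in> Upsilon"
    have "mix_norm (one_vec \<epsilon> A) \<le> (\<Sum>n\<in>A. mix_norm (mix_scale (\<epsilon> n) (mix_basis n)))"
      unfolding one_vec_def by (intro nrm_sum_le carrier_scale basis_in)
    also have "\<dots> = real (card A)"
      using *(6) by (simp add: nrm_scale basis_in mix_norm_basis Upsilon_def)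
    finally have num: "mix_norm (one_vec \<epsilon> A) \<le> real N"
      using *(4,5) by linarith
    obtain n where "n \<in> B" using *(3) by blast
    then have den: "1 \<le> mix_norm (one_vec \<eta> B)"
      using norm_le_mix_norm[OF one_vec_in[unfolded X_def], of \<eta> B n] *(2,7)
      by (simp add: estar_one_vec Upsilon_def)
    have "mix_norm (one_vec \<epsilon> A) / mix_norm (one_vec \<eta> B) \<le> real N / 1"
      using num den by (intro frac_le) auto
    then show "r \<le> ennreal (real N)"
      unfolding r by (simp add: ennreal_leI)
  qed
  have upper: "c + g_tilde N * mu_tilde N \<le> ennreal (1 + real N)" if "c \<le> 1" for c
  proof -
    have "c + g_tilde N * mu_tilde N \<le> 1 + 1 * ennreal (real N)"
      by (intro add_mono mult_mono that g_tilde_le mu_tilde_le) simp_all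
    also have "\<dots> = ennreal (1 + real N)"
      by (simp add: ennreal_plus)
    finally show ?thesis .
  qed

  \<comment> \<open>Up to 2 * N there are N + 1 even numbers, forming E, and N odd ones, forming B;
    A omits only the last even number. All nonzero coefficients of x equal 1, so B is
    greedy.\<close>
  define A B E where "A = (\<lambda>i. 2 * i) ` {..<N}" and "B = (\<lambda>i. 2 * i + 1) ` {..<N}"
    and "E = (\<lambda>i. 2 * i) ` {..N}"
  define x :: "nat \<Rightarrow> 'k" where "x = (\<lambda>n. if n \<le> 2 * N then 1 else 0)"
  have A: "finite A" "card A \<le> N"
    unfolding A_def using card_image_le[of "{..<N}"] by auto
  have B: "finite B" "card B = N" "\<And>n. n \<in> B \<Longrightarrow> n \<le> 2 * N \<and> odd n"
    unfolding B_def by (auto simp: card_image inj_on_def)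
  have E: "E \<in> mix_sets" "card E = N + 1" "\<And>n. n \<in> E \<Longrightarrow> n \<le> 2 * N \<and> even n"
    unfolding E_def mix_sets_def by (auto simp: card_image inj_on_def)
  have x: "x \<in> X"
    unfolding X_def x_def by (intro mix_space_finite_support) simp
  have "norm (x m) \<le> norm (x n)" if "n \<in> B" for m n
    using B(3)[OF that] by (simp add: x_def)
  then have "B \<in> greedy_sets x N"
    using B(1,2) by (simp add: greedy_sets_def)
  \<comment> \<open>A greedy operator must choose a set at every point: B is prescribed at x, and
    any greedy set is taken elsewhere.\<close>
  define G where "G = (\<lambda>y. if y = x then P B y else P (SOME \<Gamma>. \<Gamma> \<in> greedy_sets y N) y)"
  have G: "G \<in> greedy_operators N"
    unfolding greedy_operators_def
  proof (intro CollectI ballI)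
    fix y assume "y \<in> X"
    then have "(SOME \<Gamma>. \<Gamma> \<in> greedy_sets y N) \<in> greedy_sets y N"
      by (rule someI_ex[OF greedy_sets_nonempty])
    with \<open>B \<in> greedy_sets x N\<close> show "\<exists>\<Gamma>\<in>greedy_sets y N. G y = P \<Gamma> y"
      unfolding G_def by (cases "y = x") auto
  qed
  have "real (N + 1) = (\<Sum>n\<in>E. norm ((x - P B x) n))"
  proof -
    have "norm ((x - P B x) n) = 1" if "n \<in> E" for n
      using B(1) B(3)[of n] E(3)[OF that] by (auto simp: P_apply x_def)
    then show ?thesis using E(2) by simp
  qed
  also have "\<dots> \<le> mix_norm (x - P B x)"
    using E(1) carrier_diff[OF x P_in] unfolding X_def by (intro sum_le_mix_norm)
  finally have "1 + real N \<le> mix_norm (x - G x)"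
    by (simp add: G_def)
  then have large: "ennreal (1 + real N) \<le> ennreal (mix_norm (x - G x))"
    by (rule ennreal_leI)
  have "mix_norm (x - P A x) \<le> 1"
  proof (rule mix_norm_le)
    have le1: "norm ((x - P A x) n) \<le> 1" for n
      using A(1) by (simp add: P_apply x_def)
    fix F assume F: "F \<in> mix_sets"
    then consider n where "F = {n}" | "finite F" "\<And>n. n \<in> F \<Longrightarrow> even n"
      by (auto simp: mix_sets_def)
    then show "(\<Sum>n\<in>F. norm ((x - P A x) n)) \<le> 1"
    proof cases
      case 1
      then show ?thesis using le1 by simp
    next
      case 2
      \<comment> \<open>Once A is removed, 2 * N is the only even index with a nonzero
        coefficient.\<close>
      have "norm ((x - P A x) n) = (if n = 2 * N then norm ((x - P A x) n) else 0)"
        if "n \<in> F" for n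
      proof (cases "n = 2 * N")
        case False
        obtain i where i: "n = 2 * i" using 2(2)[OF \<open>n \<in> F\<close>] by (elim evenE)
        have "n \<in> A" if "n \<le> 2 * N"
          using that False unfolding A_def i by (intro imageI) simp
        then show ?thesis
          using A(1) False by (simp add: P_apply x_def)
      qed simp
      then have "(\<Sum>n\<in>F. norm ((x - P A x) n))
          = (\<Sum>n\<in>F. if n = 2 * N then norm ((x - P A x) n) else 0)"
        by (intro sum.cong) simp_all
      also have "\<dots> = (if 2 * N \<in> F then norm ((x - P A x) (2 * N)) else 0)"
        using 2(1) by (rule sum.delta)
      also have "\<dots> \<le> 1"
        using le1 by (cases "2 * N \<in> F") simp_all
      finally show ?thesis .
    qed
  qed
  then have small: "ennreal (mix_norm (x - P A x)) \<le> 1"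
    by (simp add: ennreal_le_1)

  have "P A x \<in> Sigma_N N"
    unfolding Sigma_N_def P_def using A by blast
  then have "sigma N x \<le> 1"
    unfolding sigma_def by (rule INF_lower2) (rule small)
  have "sigma_tilde N x \<le> 1"
    unfolding sigma_tilde_def by (rule INF_lower2[where i = A]) (use A small in simp_all)
  \<comment> \<open>A constant admissible at x and G is multiplied by an approximation error s of at
    most 1, so it must itself reach 1 + N.\<close>
  have lower: "ennreal (1 + real N) \<le> C"
    if "ennreal (mix_norm (x - G x)) \<le> C * s" "s \<le> 1" for C s
  proof -
    have "C * s \<le> C * 1"
      using that(2) by (rule mult_left_mono) simp
    with large that(1) show ?thesis
      by (metis mult.right_neutral order_trans)
  qed
  have "ennreal (1 + real N) \<le> L N"
    unfolding L_def using x G \<open>sigma N x \<le> 1\<close> by (intro Inf_greatest) (blast intro: lower)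
  with L_le[of N] upper[OF kc_le, of "2 * N"] show ?L
    by (meson antisym order_trans)
  have "ennreal (1 + real N) \<le> L_tilde N"
    unfolding L_tilde_def using x G \<open>sigma_tilde N x \<le> 1\<close>
    by (intro Inf_greatest) (blast intro: lower)
  with L_tilde_le[OF \<open>1 \<le> N\<close>] upper[OF gc_le] show ?L_tilde
    by (meson antisym order_trans)
qed

section \<open>The inequalities and the extremal example over both scalar fields\<close>

theorem theorem1p5:
  shows
    "(\<forall>(scale :: real \<Rightarrow> 'a::ab_group_add \<Rightarrow> 'a) X nrm e estar.
        seminormalized_system scale X nrm e estar \<longrightarrow>
        (\<forall>N\<ge>1.
           seminormalized_system.L scale X nrm e estar N
             \<le> seminormalized_system.kc scale X nrm e estar (2 * N)
               + seminormalized_system.g_tilde scale X nrm e estar N * seminormalized_system.mu_tilde scale nrm e N \<and>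
           seminormalized_system.L_tilde scale X nrm e estar N
             \<le> seminormalized_system.gc scale X nrm e estar N
               + seminormalized_system.g_tilde scale X nrm e estar N * seminormalized_system.mu_tilde scale nrm e N)) \<and>
     (\<forall>(scale :: complex \<Rightarrow> 'b::ab_group_add \<Rightarrow> 'b) X nrm e estar.
        seminormalized_system scale X nrm e estar \<longrightarrow>
        (\<forall>N\<ge>1.
           seminormalized_system.L scale X nrm e estar N
             \<le> seminormalized_system.kc scale X nrm e estar (2 * N)
               + seminormalized_system.g_tilde scale X nrm e estar N * seminormalized_system.mu_tilde scale nrm e N \<and>
           seminormalized_system.L_tilde scale X nrm e estar N
             \<le> seminormalized_system.gc scale X nrm e estar N
               + seminormalized_system.g_tilde scale X nrm e estar N * seminormalized_system.mu_tilde scale nrm e N)) \<and>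
     (\<exists>(scale :: real \<Rightarrow> (nat \<Rightarrow> real) \<Rightarrow> (nat \<Rightarrow> real)) X nrm e estar.
        seminormalized_system scale X nrm e estar \<and>
        (\<forall>N\<ge>1.
           seminormalized_system.L scale X nrm e estar N
             = seminormalized_system.kc scale X nrm e estar (2 * N)
               + seminormalized_system.g_tilde scale X nrm e estar N * seminormalized_system.mu_tilde scale nrm e N \<and>
           seminormalized_system.L_tilde scale X nrm e estar N
             = seminormalized_system.gc scale X nrm e estar N
               + seminormalized_system.g_tilde scale X nrm e estar N * seminormalized_system.mu_tilde scale nrm e N)) \<and>
     (\<exists>(scale :: complex \<Rightarrow> (nat \<Rightarrow> complex) \<Rightarrow> (nat \<Rightarrow> complex)) X nrm e estar.
        seminormalized_system scale X nrm e estar \<and>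
        (\<forall>N\<ge>1.
           seminormalized_system.L scale X nrm e estar N
             = seminormalized_system.kc scale X nrm e estar (2 * N)
               + seminormalized_system.g_tilde scale X nrm e estar N * seminormalized_system.mu_tilde scale nrm e N \<and>
           seminormalized_system.L_tilde scale X nrm e estar N
             = seminormalized_system.gc scale X nrm e estar N
               + seminormalized_system.g_tilde scale X nrm e estar N * seminormalized_system.mu_tilde scale nrm e N))"
proof (intro conjI, goal_cases)
  case 1
  show ?case
    by (intro allI impI conjI seminormalized_system.L_le seminormalized_system.L_tilde_le)
next
  case 2
  show ?case
    by (intro allI impI conjI seminormalized_system.L_le seminormalized_system.L_tilde_le)
next
  case 3
  show ?case
    by (rule exI[of _ mix_scale], rule exI[of _ mix_space], rule exI[of _ mix_norm],
        rule exI[of _ mix_basis], rule exI[of _ "\<lambda>n f. f n"])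
      (intro conjI allI impI mix_system mix_equalities)
next
  case 4
  show ?case
    by (rule exI[of _ mix_scale], rule exI[of _ mix_space], rule exI[of _ mix_norm],
        rule exI[of _ mix_basis], rule exI[of _ "\<lambda>n f. f n"])
      (intro conjI allI impI mix_system mix_equalities)
qed

end
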